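(* Let $I\subset\mathbb{R}$ be an open interval and let $f\in C^{(3)}(I)$ satisfy: there are constants $c_1>c_2>0$ with $c_2<f'(x)<c_1$ for all $x\in I$, and $f''(x)\neq 0$ for all $x\in I$. Let $C_f=\{(x,f(x)):x\in I\}$. Let $\psi_1,\psi_2:\mathbb{R}^+\to\mathbb{R}^+$ be decreasing functions. If \[ \sum_{h=1}^{\infty}\psi_1(h)\psi_2(h)<\infty, \] then $|C_f\cap \mathcal{S}_2(\psi_1,\psi_2)|_{C_f}=0$.
   Context: For $x\in\mathbb{R}$, $\|x\|=\min\{|x-z|:z\in\mathbb{Z}\}$ denotes the distance from $x$ to the nearest integer. For decreasing functions $\psi_1,\psi_2:\mathbb{R}^+\to\mathbb{R}^+$, the set of simultaneously $(\psi_1,\psi_2)$-approximable points is \[ \mathcal{S}_2(\psi_1,\psi_2)=\{(x,y)\in\mathbb{R}^2:\ \|qx\|<\psi_1(q)\text{ and }\|qy\|<\psi_2(q)\text{ for infinitely many } q\in\mathbb{N}\}. \] $|\cdot|_{C_f}$ denotes the induced (one-dimensional, arc-length) measure on the curve $C_f$; equivalently, a subset $A\subset C_f$ has $|A|_{C_f}=0$ iff the set $\{x\in I:(x,f(x))\in A\}$ has Lebesgue measure zero. *)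

theory Defs
  imports "HOL-Analysis.Analysis"
begin

definition dist_nint :: "real \<Rightarrow> real" where
  "dist_nint x = (INF z\<in>(\<int>::real set). \<bar>x - z\<bar>)"

definition S2 :: "(real \<Rightarrow> real) \<Rightarrow> (real \<Rightarrow> real) \<Rightarrow> (real \<times> real) set" where
  "S2 \<psi>1 \<psi>2 = {(x, y). infinite {q::nat. q > 0 \<and>
       dist_nint (real q * x) < \<psi>1 (real q) \<and> dist_nint (real q * y) < \<psi>2 (real q)}}"

end

theory Submission
  imports Defs
begin

text \<open>Work on a compact arc and on the dyadic range \<open>Q \<le> q < 2 * Q\<close>, and let \<open>\<delta>\<close> be the larger of
  \<open>\<psi>1 Q\<close>, \<open>\<psi>2 Q\<close> and \<open>Q powr (-11/20)\<close>. A pair of fractions with denominator \<open>q\<close> approximates the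
  points of a piece of the arc of length \<open>O(min (\<psi>1 Q) (\<psi>2 Q) / Q)\<close>, because \<open>f'\<close> is bounded away
  from \<open>0\<close>. So it suffices to show that only \<open>O(\<delta> * Q\<^sup>2)\<close> rational points lie within \<open>\<delta> / Q\<close> of the
  arc, outside a set of special points: then the measures add up to \<open>O(Q * \<psi>1 Q * \<psi>2 Q)\<close> plus a
  negative power of \<open>Q\<close>, which is summable over dyadic \<open>Q\<close> by condensation, and the Borel-Cantelli
  lemma applies.

  Over a subarc of length \<open>sqrt (\<delta> / Q)\<close> the relevant integer points \<open>(q, p, r)\<close> lie in a
  parallelepiped. A large sieve argument bounds their number by the volume, unless the polar body
  contains a nonzero integer point \<open>(a, b, c)\<close>, that is, a rational line \<open>a + b * x + c * y = 0\<close> of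
  small height which is nearly tangent to the arc throughout the subarc.

  The set of such special points has measure \<open>O(Q powr -\<eta>)\<close>. Subdivide it according to the size \<open>B\<close> of
  \<open>c\<close> and into subarcs of length slightly larger than the typical domain of influence of one line. A
  subarc met by only one line contributes little. Two lines meeting the same subarc intersect in a
  rational point which approximates the \<open>x\<close>-coordinate of the whole subarc so well that all such
  subarcs together are negligible.\<close>

section \<open>Outer measure bounds\<close>

text \<open>Outer measure through a measurable superset: the exceptional sets below are never shown
  to be measurable, and Borel-Cantelli needs only covers of small measure.\<close>

definition outer_le :: "real set \<Rightarrow> real \<Rightarrow> bool" where
  "outer_le X b \<longleftrightarrow> (\<exists>Y\<in>lmeasurable. X \<subseteq> Y \<and> measure lebesgue Y \<le> b)"

lemma outer_le_mono: "outer_le X b \<Longrightarrow> W \<subseteq> X \<Longrightarrow> b \<le> c \<Longrightarrow> outer_le W c"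
  unfolding outer_le_def by (auto intro: order_trans)

lemma outer_le_UN:
  assumes "finite A" and "\<And>i. i \<in> A \<Longrightarrow> outer_le (X i) (b i)"
  shows "outer_le (\<Union>i\<in>A. X i) (sum b A)"
proof -
  obtain Y where Y: "\<And>i. i \<in> A \<Longrightarrow> Y i \<in> lmeasurable \<and> X i \<subseteq> Y i \<and> measure lebesgue (Y i) \<le> b i"
    using assms(2) unfolding outer_le_def by metis
  have "(\<Union>i\<in>A. Y i) \<in> lmeasurable" using assms(1) Y by (intro fmeasurable.finite_UN) auto
  moreover have "measure lebesgue (\<Union>i\<in>A. Y i) \<le> (\<Sum>i\<in>A. measure lebesgue (Y i))"
    using assms(1) Y by (intro measure_UNION_le) (auto intro: fmeasurableD)
  moreover have "\<dots> \<le> sum b A" using Y by (intro sum_mono) auto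
  moreover have "(\<Union>i\<in>A. X i) \<subseteq> (\<Union>i\<in>A. Y i)" using Y by (intro UN_mono) auto
  ultimately show ?thesis unfolding outer_le_def by (meson order_trans)
qed

lemma outer_le_UN_const:
  assumes "finite A" and "\<And>i. i \<in> A \<Longrightarrow> outer_le (X i) c" and "real (card A) \<le> n" and "0 \<le> c"
  shows "outer_le (\<Union>i\<in>A. X i) (n * c)"
proof (rule outer_le_mono)
  show "outer_le (\<Union>i\<in>A. X i) (\<Sum>i\<in>A. c)" using assms(1,2) by (rule outer_le_UN)
  show "(\<Sum>i\<in>A. c) \<le> n * c" using assms(3,4) by (simp add: mult_right_mono)
qed simp

lemma outer_le_Un:
  assumes "outer_le X b" "outer_le Y c"
  shows "outer_le (X \<union> Y) (b + c)"
  using outer_le_UN[of "{True, False}" "\<lambda>i. if i then X else Y" "\<lambda>i. if i then b else c"] assms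
  by (simp add: Un_commute)

lemma outer_le_diam:
  assumes "\<And>x y. x \<in> X \<Longrightarrow> y \<in> X \<Longrightarrow> x \<le> y \<Longrightarrow> y - x \<le> d" and "0 \<le> d"
  shows "outer_le X (2 * d)"
proof (cases "X = {}")
  case True
  then show ?thesis using assms(2) unfolding outer_le_def by (intro bexI[of _ "{}"]) auto
next
  case False
  then obtain z where "z \<in> X" by auto
  have "X \<subseteq> {z - d .. z + d}"
  proof
    fix x assume "x \<in> X"
    then show "x \<in> {z - d .. z + d}"
      using assms(1)[of x z] assms(1)[of z x] \<open>z \<in> X\<close> by fastforce
  qed
  then show ?thesis using assms(2) unfolding outer_le_def by (intro bexI[of _ "{z - d..z + d}"]) auto
qed

lemma outer_le_empty: "0 \<le> c \<Longrightarrow> outer_le {} c"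
  unfolding outer_le_def by (intro bexI[of _ "{}"]) auto

text \<open>The hypothesis \<open>each\<close> ranges over all windows of length \<open>l\<close>,
  so applications argue in a single window. The summand 1 pays for the window at the right
  end.\<close>

lemma outer_le_partition:
  assumes l: "l > 0" and c: "0 \<le> c" and uv: "u \<le> v" and X: "X \<subseteq> {u..v}"
    and each: "\<And>t. outer_le (X \<inter> {t..t + l}) c"
  shows "outer_le X (((v - u) / l + 1) * c)"
proof (rule outer_le_mono)
  let ?n = "nat \<lfloor>(v - u) / l\<rfloor>"
  have "real ?n \<le> (v - u) / l" using uv l by (intro of_nat_floor) simp
  then show "outer_le (\<Union>j\<in>{..?n}. X \<inter> {u + j * l..u + j * l + l}) (((v - u) / l + 1) * c)"
    by (intro outer_le_UN_const each c) auto
  show "X \<subseteq> (\<Union>j\<in>{..?n}. X \<inter> {u + j * l..u + j * l + l})"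
  proof
    fix x assume x: "x \<in> X"
    define j where "j = nat \<lfloor>(x - u) / l\<rfloor>"
    have xu: "u \<le> x" "x \<le> v" using x X by auto
    have "(x - u) / l \<ge> 0" using xu l by simp
    then have j: "real j \<le> (x - u) / l" "(x - u) / l < real j + 1" unfolding j_def by linarith+
    have "(x - u) / l \<le> (v - u) / l" using xu l by (intro divide_right_mono) auto
    then have "j \<le> ?n" unfolding j_def by (intro nat_mono floor_mono)
    moreover have "u + j * l \<le> x" "x \<le> u + j * l + l"
      using j l by (simp_all add: field_simps)
    ultimately show "x \<in> (\<Union>j\<in>{..?n}. X \<inter> {u + j * l..u + j * l + l})" using x by auto
  qed
qed simp

text \<open>Borel-Cantelli applied to the measurable covers; shifting the index by \<open>k0\<close>
  discards the initial sets, about which nothing is assumed.\<close>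

lemma negligible_limsup_outer_le:
  assumes "\<And>k::nat. k \<ge> k0 \<Longrightarrow> outer_le (L k) (b k)" and "summable b"
    and "\<And>x N. x \<in> X \<Longrightarrow> \<exists>k\<ge>N. x \<in> L k"
  shows "X \<in> null_sets lebesgue"
proof -
  obtain Y where Y: "\<And>k. k \<ge> k0 \<Longrightarrow> Y k \<in> lmeasurable \<and> L k \<subseteq> Y k \<and> measure lebesgue (Y k) \<le> b k"
    using assms(1) unfolding outer_le_def by metis
  have "limsup (\<lambda>k. Y (k + k0)) \<in> null_sets lebesgue"
  proof (rule borel_cantelli_limsup1)
    show "summable (\<lambda>k. measure lebesgue (Y (k + k0)))"
      by (rule summable_comparison_test[OF _ summable_ignore_initial_segment[OF assms(2), of k0]])
         (use Y in auto)
    fix n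
    have "Y (n + k0) \<in> lmeasurable" using Y[of "n + k0"] by simp
    then show "Y (n + k0) \<in> sets lebesgue" "emeasure lebesgue (Y (n + k0)) < \<infinity>"
      by (simp_all only: fmeasurable_def mem_Collect_eq infinity_ennreal_def)
  qed
  moreover have "X \<subseteq> limsup (\<lambda>k. Y (k + k0))"
  proof
    fix x assume x: "x \<in> X"
    have "\<exists>m\<ge>n. x \<in> Y (m + k0)" for n
    proof -
      obtain k where "k \<ge> n + k0" "x \<in> L k" using assms(3)[OF x] by blast
      then show ?thesis using Y[of k] by (intro exI[of _ "k - k0"]) auto
    qed
    then show "x \<in> limsup (\<lambda>k. Y (k + k0))" by (auto simp: limsup_INF_SUP)
  qed
  ultimately show ?thesis by (meson negligible_iff_null_sets negligible_subset)
qed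

text \<open>Since \<open>F'\<close> increases at rate at least \<open>\<mu>\<close>, the interval
  splits by the size of \<open>F'\<close> against \<open>\<mu> * g\<close>. Where \<open>F'\<close>
  is small, its growth bounds the diameter; on the two steep sides the mean value theorem does, as
  \<open>F\<close> varies by at most \<open>2 * \<tau>\<close>. Each piece has diameter at most
  \<open>2 * g\<close> and costs \<open>4 * g\<close>.\<close>

lemma outer_le_sublevel:
  fixes F F' :: "real \<Rightarrow> real"
  assumes deriv: "\<And>x. x \<in> {u..v} \<Longrightarrow> (F has_real_derivative F' x) (at x)"
    and growth: "\<And>x y. u \<le> x \<Longrightarrow> x \<le> y \<Longrightarrow> y \<le> v \<Longrightarrow> \<mu> * (y - x) \<le> F' y - F' x"
    and pos: "\<mu> > 0" "g > 0" and \<tau>: "\<tau> \<le> \<mu> * g\<^sup>2"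
  shows "outer_le {x \<in> {u..v}. \<bar>F x\<bar> \<le> \<tau>} (12 * g)"
proof -
  let ?S = "{x \<in> {u..v}. \<bar>F x\<bar> \<le> \<tau>}"
  have mvt: "\<exists>z. x \<le> z \<and> z \<le> y \<and> F y - F x = (y - x) * F' z" if "u \<le> x" "x \<le> y" "y \<le> v" for x y
  proof (cases "x = y")
    case False
    then have "\<exists>z>x. z < y \<and> F y - F x = (y - x) * F' z"
      using that by (intro MVT2) (auto intro: deriv)
    then show ?thesis by (meson less_imp_le)
  qed auto
  have mono: "F' x \<le> F' y" if "u \<le> x" "x \<le> y" "y \<le> v" for x y
  proof -
    have "0 \<le> \<mu> * (y - x)" using pos that by simp
    then show ?thesis using growth[OF that] by linarith
  qed
  have steep: "y - x \<le> 2 * g" if "(y - x) * (\<mu> * g) \<le> 2 * \<tau>" for x y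
  proof -
    have "(\<mu> * g) * (y - x) \<le> (\<mu> * g) * (2 * g)" using that \<tau> by (simp add: power2_eq_square mult_ac)
    then show ?thesis using pos by (simp add: mult_le_cancel_left)
  qed
  have 1: "outer_le {x \<in> ?S. \<bar>F' x\<bar> \<le> \<mu> * g} (2 * (2 * g))"
  proof (rule outer_le_diam)
    fix x y assume "x \<in> {x \<in> ?S. \<bar>F' x\<bar> \<le> \<mu> * g}" "y \<in> {x \<in> ?S. \<bar>F' x\<bar> \<le> \<mu> * g}" "x \<le> y"
    then have "\<mu> * (y - x) \<le> \<mu> * (2 * g)" using growth[of x y] by auto
    then show "y - x \<le> 2 * g" using pos by simp
  qed (use pos in auto)
  have 2: "outer_le {x \<in> ?S. F' x > \<mu> * g} (2 * (2 * g))"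
  proof (rule outer_le_diam)
    fix x y assume xy: "x \<in> {x \<in> ?S. F' x > \<mu> * g}" "y \<in> {x \<in> ?S. F' x > \<mu> * g}" "x \<le> y"
    then obtain z where z: "x \<le> z" "z \<le> y" "F y - F x = (y - x) * F' z" using mvt[of x y] by auto
    have "(y - x) * (\<mu> * g) \<le> (y - x) * F' z"
      using mono[of x z] xy z by (intro mult_left_mono) auto
    then show "y - x \<le> 2 * g" using xy z by (intro steep) auto
  qed (use pos in auto)
  have 3: "outer_le {x \<in> ?S. F' x < - (\<mu> * g)} (2 * (2 * g))"
  proof (rule outer_le_diam)
    fix x y assume xy: "x \<in> {x \<in> ?S. F' x < - (\<mu> * g)}" "y \<in> {x \<in> ?S. F' x < - (\<mu> * g)}" "x \<le> y"
    then obtain z where z: "x \<le> z" "z \<le> y" "F y - F x = (y - x) * F' z" using mvt[of x y] by auto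
    have "(y - x) * (\<mu> * g) \<le> (y - x) * (- F' z)"
      using mono[of z y] xy z by (intro mult_left_mono) auto
    then show "y - x \<le> 2 * g" using xy z by (intro steep) auto
  qed (use pos in auto)
  show ?thesis
    by (rule outer_le_mono[OF outer_le_Un[OF 1 outer_le_Un[OF 2 3]]]) (use pos in auto)
qed

text \<open>A denominator \<open>q\<close> has \<open>O(q)\<close> admissible numerators, each with
  a neighbourhood of length \<open>O(w / q)\<close>. Every denominator thus costs the same, and only
  their number \<open>W\<close> matters.\<close>

lemma outer_le_approximable:
  fixes w W u v :: real
  assumes uv: "u \<le> v" and w: "0 \<le> w" "w \<le> 1" and W: "0 \<le> W"
  shows "outer_le {x \<in> {u..v}. \<exists>(q::int) (p::int). q \<noteq> 0 \<and> \<bar>real_of_int q\<bar> \<le> W \<and> \<bar>p - q * x\<bar> \<le> w}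
           (W * ((v - u + 3) * (4 * w)))" (is "outer_le ?Z _")
proof (rule outer_le_mono)
  define P where "P q = {\<lceil>q * u - w\<rceil>..\<lfloor>q * v + w\<rfloor>}" for q :: int
  have single: "outer_le {x \<in> {u..v}. \<bar>p - q * x\<bar> \<le> w} (2 * (2 * w / q))" if "q \<ge> 1" for p q :: int
  proof (rule outer_le_diam)
    fix x y :: real assume "x \<in> {x \<in> {u..v}. \<bar>p - q * x\<bar> \<le> w}" "y \<in> {x \<in> {u..v}. \<bar>p - q * x\<bar> \<le> w}"
    then have "q * y - q * x \<le> 2 * w" by (auto simp: abs_le_iff)
    then show "y - x \<le> 2 * w / q" using that by (simp add: field_simps)
  qed (use that w in simp)
  have inner: "outer_le (\<Union>p\<in>P q. {x \<in> {u..v}. \<bar>p - q * x\<bar> \<le> w}) ((v - u + 3) * (4 * w))"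
    if q: "q \<ge> 1" for q :: int
  proof (rule outer_le_mono)
    have "0 \<le> q * (v - u)" using uv q by simp
    then have "real (card (P q)) \<le> q * (v - u) + 2 * w + 1"
      unfolding P_def right_diff_distrib using w by (simp; linarith)
    also have "\<dots> \<le> q * (v - u + 3)" using w q by (simp add: algebra_simps)
    finally show "outer_le (\<Union>p\<in>P q. {x \<in> {u..v}. \<bar>p - q * x\<bar> \<le> w}) (q * (v - u + 3) * (2 * (2 * w / q)))"
      using single q w by (intro outer_le_UN_const) (auto simp: P_def)
    show "q * (v - u + 3) * (2 * (2 * w / q)) \<le> (v - u + 3) * (4 * w)" using q by simp
  qed simp
  show "outer_le (\<Union>q\<in>{1..\<lfloor>W\<rfloor>}. \<Union>p\<in>P q. {x \<in> {u..v}. \<bar>p - q * x\<bar> \<le> w}) (W * ((v - u + 3) * (4 * w)))"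
    by (rule outer_le_UN_const) (use inner W uv w in auto)
  show "?Z \<subseteq> (\<Union>q\<in>{1..\<lfloor>W\<rfloor>}. \<Union>p\<in>P q. {x \<in> {u..v}. \<bar>p - q * x\<bar> \<le> w})"
  proof
    fix x assume "x \<in> ?Z"
    then obtain q p :: int where x: "x \<in> {u..v}" and qp: "q \<noteq> 0" "\<bar>real_of_int q\<bar> \<le> W" "\<bar>p - q * x\<bar> \<le> w"
      by blast
    have *: "x \<in> (\<Union>q\<in>{1..\<lfloor>W\<rfloor>}. \<Union>p\<in>P q. {x \<in> {u..v}. \<bar>p - q * x\<bar> \<le> w})"
      if q: "q \<ge> 1" "real_of_int q \<le> W" "\<bar>p - q * x\<bar> \<le> w" for p q :: int
    proof -
      have "q * u \<le> q * x" "q * x \<le> q * v" using q(1) x by auto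
      then have "p \<in> P q" using q(3) unfolding P_def by (simp add: ceiling_le_iff le_floor_iff abs_le_iff)
      moreover have "q \<in> {1..\<lfloor>W\<rfloor>}" using q by (simp add: le_floor_iff)
      ultimately show ?thesis using x q(3) by blast
    qed
    show "x \<in> (\<Union>q\<in>{1..\<lfloor>W\<rfloor>}. \<Union>p\<in>P q. {x \<in> {u..v}. \<bar>p - q * x\<bar> \<le> w})"
    proof (cases "q > 0")
      case True then show ?thesis using *[of q p] qp by auto
    next
      case False
      then show ?thesis using *[of "- q" "- p"] qp by auto
    qed
  qed
qed simp

text \<open>The cap at 1 is free because rounding already gives distance at most 1/2. It keeps later
  thresholds bounded even where \<open>\<psi>1\<close> or \<open>\<psi>2\<close> is large.\<close>

lemma dist_nint_less:
  fixes x \<rho> :: real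
  assumes "dist_nint x < \<rho>"
  obtains z :: int where "\<bar>z - x\<bar> < min 1 \<rho>"
proof -
  have bdd: "bdd_below ((\<lambda>z. \<bar>x - z\<bar>) ` (\<int>::real set))" by (rule bdd_belowI[of _ 0]) auto
  have "\<exists>z\<in>(\<int>::real set). \<bar>x - z\<bar> < \<rho>"
    using assms unfolding dist_nint_def by (subst (asm) cINF_less_iff[OF _ bdd]) auto
  then obtain z :: int where z: "\<bar>x - real_of_int z\<bar> < \<rho>" by (auto elim: Ints_cases)
  show ?thesis
  proof (cases "\<rho> \<le> 1")
    case True
    then show ?thesis using z by (intro that[of z]) auto
  next
    case False
    have "\<bar>round x - x\<bar> \<le> 1/2" by (rule of_int_round_abs_le)
    then show ?thesis using False by (intro that[of "round x"]) auto
  qed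
qed

lemma summable_dyadic:
  fixes g :: "real \<Rightarrow> real"
  assumes pos: "\<And>t. t > 0 \<Longrightarrow> 0 \<le> g t" and dec: "\<And>x y. 0 < x \<Longrightarrow> x \<le> y \<Longrightarrow> g y \<le> g x"
    and sum: "summable (\<lambda>n. g (real (Suc n)))"
  shows "summable (\<lambda>k. 2 ^ k * g (2 ^ k))"
proof -
  \<comment> \<open>Nothing is known about \<open>g 0\<close>, so the term of index 0 is replaced by
    0 before Cauchy condensation.\<close>
  define h where "h n = (if n = 0 then 0 else g (real n))" for n
  have "summable (\<lambda>n. h (Suc n))" using sum by (simp add: h_def)
  then have "summable h" by (simp only: summable_Suc_iff)
  moreover have "summable h \<longleftrightarrow> summable (\<lambda>n. 2 ^ n * h (2 ^ n))"
    by (rule condensation_test) (auto simp: h_def intro!: pos dec)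
  ultimately show ?thesis by (simp add: h_def)
qed

section \<open>Integer points in boxes\<close>

lemma abs_add3_le: "\<bar>a\<bar> \<le> A \<Longrightarrow> \<bar>b\<bar> \<le> B \<Longrightarrow> \<bar>c\<bar> \<le> C \<Longrightarrow> \<bar>a + b + c\<bar> \<le> A + B + C"
  for a b c :: real
  by linarith

lemma sum_cis_multiples:
  fixes d :: int
  assumes "M > 0" and "\<bar>d\<bar> < int M"
  shows "(\<Sum>t\<in>{0..<int M}. cis (2 * pi * (d * t) / M)) = (if d = 0 then of_nat M else 0)"
proof (cases "d = 0")
  case False
  define z where "z = cis (2 * pi * d / M)"
  have "z ^ M = cis (2 * pi * d)" using assms by (simp add: z_def Complex.DeMoivre)
  then have zM: "z ^ M = 1" by (simp add: cis_multiple_2pi)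
  have "z \<noteq> 1"
  proof
    assume "z = 1"
    then have "cos (2 * pi * d / M) = 1" by (metis z_def cis.sel(1) one_complex.sel(1))
    then obtain n :: int where "2 * pi * d / M = n * 2 * pi" by (auto simp: cos_one_2pi_int)
    then have "real_of_int d = real_of_int (n * int M)" using assms by (simp add: field_simps)
    then have "d = n * int M" by linarith
    then have "int M dvd d" by simp
    then show False using assms False dvd_imp_le_int[of d "int M"] by auto
  qed
  have "(\<Sum>t\<in>{0..<int M}. cis (2 * pi * (d * t) / M)) = (\<Sum>t<M. z ^ t)"
    unfolding z_def Complex.DeMoivre
    by (rule sum.reindex_bij_witness[of _ int nat]) (auto simp: mult_ac)
  also have "\<dots> = 0" using zM \<open>z \<noteq> 1\<close> by (simp add: sum_gp_strict)
  finally show ?thesis using False by simp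
qed auto

text \<open>Parseval's identity on the cube of the integers modulo \<open>M\<close>: by
  \<open>bound\<close>, distinct frequencies in \<open>V\<close> remain distinct modulo
  \<open>M\<close>, so the off-diagonal terms vanish.\<close>

lemma sum_norm_square_trig_poly:
  fixes V :: "(int \<times> int \<times> int) set"
  assumes M: "M > 0" and V: "finite V"
    and bound: "\<And>q p r. (q, p, r) \<in> V \<Longrightarrow> 2 * \<bar>q\<bar> < int M \<and> 2 * \<bar>p\<bar> < int M \<and> 2 * \<bar>r\<bar> < int M"
  shows "(\<Sum>(a,b,c)\<in>{0..<int M} \<times> {0..<int M} \<times> {0..<int M}.
            (cmod (\<Sum>(q,p,r)\<in>V. cis (2 * pi * (q * a + p * b + r * c) / M)))\<^sup>2)
         = real M ^ 3 * card V" (is "?L = _")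
proof -
  let ?I = "{0..<int M}" and ?P = "{0..<int M} \<times> {0..<int M} \<times> {0..<int M}"
  define e where "e d a = cis (2 * pi * (d * a) / M)" for d a :: int
  define E where "E = (\<lambda>(q,p,r) (a,b,c). e q a * e p b * e r c)"
  have S: "(\<Sum>(q,p,r)\<in>V. cis (2 * pi * (q * a + p * b + r * c) / M)) = (\<Sum>v\<in>V. E v (a,b,c))" for a b c :: int
    by (rule sum.cong) (auto simp: E_def e_def cis_mult add_divide_distrib distrib_left)
  have orth: "(\<Sum>t\<in>?P. E v t * cnj (E w t)) = (if v = w then of_nat M ^ 3 else 0)"
    if "v \<in> V" "w \<in> V" for v w
  proof -
    obtain q p r q' p' r' where vw: "v = (q,p,r)" "w = (q',p',r')" by (metis prod_cases3)
    have "(\<Sum>t\<in>?P. E v t * cnj (E w t))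
        = (\<Sum>a\<in>?I. \<Sum>b\<in>?I. \<Sum>c\<in>?I. e (q-q') a * (e (p-p') b * e (r-r') c))"
      unfolding sum.cartesian_product
      by (rule sum.cong)
         (auto simp: vw E_def e_def cis_mult cis_cnj add_divide_distrib diff_divide_distrib algebra_simps)
    also have "\<dots> = (\<Sum>a\<in>?I. e (q-q') a) * ((\<Sum>b\<in>?I. e (p-p') b) * (\<Sum>c\<in>?I. e (r-r') c))"
      by (simp flip: sum_distrib_left sum_distrib_right)
    also have "\<dots> = (if v = w then of_nat M ^ 3 else 0)"
    proof -
      have diff: "\<bar>i - j\<bar> < int M" if "2 * \<bar>i\<bar> < int M" "2 * \<bar>j\<bar> < int M" for i j
        using that by linarith
      note b = bound[OF that(1)[unfolded vw]] bound[OF that(2)[unfolded vw]]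
      have "\<bar>q - q'\<bar> < int M" "\<bar>p - p'\<bar> < int M" "\<bar>r - r'\<bar> < int M"
        using b by (blast intro: diff)+
      note S = this[THEN sum_cis_multiples[OF M]]
      show ?thesis unfolding e_def S by (simp add: vw power3_eq_cube)
    qed
    finally show ?thesis .
  qed
  have "?L = (\<Sum>t\<in>?P. (cmod (\<Sum>v\<in>V. E v t))\<^sup>2)"
    by (rule sum.cong[OF refl]) (clarify, simp only: S split)
  then have "complex_of_real ?L = (\<Sum>t\<in>?P. (\<Sum>v\<in>V. E v t) * cnj (\<Sum>v\<in>V. E v t))"
    by (simp only: of_real_sum complex_norm_square)
  also have "\<dots> = (\<Sum>t\<in>?P. \<Sum>v\<in>V. \<Sum>w\<in>V. E v t * cnj (E w t))"
    by (simp add: sum_product)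
  also have "\<dots> = (\<Sum>v\<in>V. \<Sum>w\<in>V. \<Sum>t\<in>?P. E v t * cnj (E w t))"
    by (subst sum.swap, rule sum.cong[OF refl], subst sum.swap) simp
  also have "\<dots> = (\<Sum>v\<in>V. \<Sum>w\<in>V. if v = w then of_nat M ^ 3 else 0)"
    by (intro sum.cong refl orth)
  also have "\<dots> = complex_of_real (real M ^ 3 * card V)"
    using V by (simp add: mult.commute)
  finally show ?thesis using of_real_eq_iff by blast
qed

text \<open>The exponential sum has period \<open>M\<close> in each variable and \<open>G\<close>
  has distinct residues, so the left side is part of the complete nonnegative sum in Parseval's
  identity.\<close>

lemma sum_trig_poly_packing:
  fixes V G :: "(int \<times> int \<times> int) set"
  assumes M: "M > 0" and V: "finite V" and G: "finite G"
    and bound: "\<And>q p r. (q, p, r) \<in> V \<Longrightarrow> 2 * \<bar>q\<bar> < int M \<and> 2 * \<bar>p\<bar> < int M \<and> 2 * \<bar>r\<bar> < int M"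
    and inj: "inj_on (\<lambda>(a,b,c). (a mod int M, b mod int M, c mod int M)) G"
  shows "(\<Sum>(a,b,c)\<in>G. (cmod (\<Sum>(q,p,r)\<in>V. cis (2 * pi * (q * a + p * b + r * c) / M)))\<^sup>2)
         \<le> real M ^ 3 * card V"
proof -
  let ?P = "{0..<int M} \<times> {0..<int M} \<times> {0..<int M}"
  let ?red = "\<lambda>(a,b,c). (a mod int M, b mod int M, c mod int M)"
  define S where "S = (\<lambda>(a,b,c). (cmod (\<Sum>(q,p,r)\<in>V. cis (2 * pi * (q * a + p * b + r * c) / M)))\<^sup>2)"
  have per: "S (?red t) = S t" for t
  proof -
    obtain a b c where t: "t = (a,b,c)" by (metis prod_cases3)
    have "cis (2 * pi * (q * (a mod int M) + p * (b mod int M) + r * (c mod int M)) / M)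
        = cis (2 * pi * (q * a + p * b + r * c) / M)" for q p r :: int
    proof -
      define n where "n = q * (a div int M) + p * (b div int M) + r * (c div int M)"
      have "q * (a mod int M) + p * (b mod int M) + r * (c mod int M)
          = q * a + p * b + r * c - int M * n"
        unfolding n_def by (simp add: minus_mult_div_eq_mod [symmetric] algebra_simps)
      then have "2 * pi * real_of_int (q * (a mod int M) + p * (b mod int M) + r * (c mod int M)) / M
          = 2 * pi * (real_of_int (q * a + p * b + r * c) - M * n) / M"
        by (simp only: of_int_diff of_int_mult of_int_of_nat_eq)
      also have "\<dots> = 2 * pi * real_of_int (q * a + p * b + r * c) / M - 2 * pi * n"
        using M by (simp add: right_diff_distrib diff_divide_distrib)
      finally show ?thesis by (simp add: cis_divide[symmetric] cis_multiple_2pi)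
    qed
    then show ?thesis by (simp add: S_def t)
  qed
  have "(\<Sum>t\<in>G. S t) = (\<Sum>t\<in>?red ` G. S t)"
    using inj by (simp only: sum.reindex o_def per)
  also have "\<dots> \<le> (\<Sum>t\<in>?P. S t)"
    using M by (intro sum_mono2) (auto simp: S_def)
  also have "\<dots> = real M ^ 3 * card V"
    using sum_norm_square_trig_poly[OF M V bound] by (simp add: S_def)
  finally show ?thesis by (simp add: S_def)
qed

lemma card_int_interval_ge:
  fixes x r :: real
  assumes "r \<ge> 1"
  shows "real (card {\<lceil>x - r\<rceil>..\<lfloor>x + r\<rfloor>}) \<ge> r"
proof -
  have "real_of_int (\<lfloor>x + r\<rfloor> - \<lceil>x - r\<rceil> + 1) \<ge> r" using assms by linarith
  then show ?thesis by simp
qed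

text \<open>A large sieve argument: the exponential sum over \<open>V\<close> is at least \<open>card V / 2\<close> in absolute
  value on the box polar to \<open>V\<close>, and by \<open>no_dual\<close> this box embeds into the torus.\<close>

lemma lattice_count_finite:
  fixes x y s \<alpha> \<beta> \<gamma> :: real and V :: "(int \<times> int \<times> int) set"
  assumes V: "finite V" and pos: "\<alpha> > 0" "\<beta> > 0" "\<gamma> > 0"
    and box: "\<And>q p r. (q, p, r) \<in> V \<Longrightarrow>
       \<bar>real_of_int q\<bar> * \<alpha> \<le> 1/18 \<and> \<bar>p - q * x\<bar> * \<beta> \<le> 1/18 \<and> \<bar>r - q * y - s * (p - q * x)\<bar> * \<gamma> \<le> 1/18"
    and no_dual: "\<And>(a::int) (b::int) (c::int). \<bar>a + b * x + c * y\<bar> \<le> 2 * \<alpha> \<Longrightarrow> \<bar>b + c * s\<bar> \<le> 2 * \<beta> \<Longrightarrow>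
       \<bar>real_of_int c\<bar> \<le> 2 * \<gamma> \<Longrightarrow> a = 0 \<and> b = 0 \<and> c = 0"
  shows "card V * (\<alpha> * \<beta> * \<gamma>) \<le> 4"
proof -
  define m where "m = Max (insert 0 ((\<lambda>(q,p,r). \<bar>q\<bar> + \<bar>p\<bar> + \<bar>r\<bar>) ` V))"
  have m: "\<bar>q\<bar> + \<bar>p\<bar> + \<bar>r\<bar> \<le> m" if "(q,p,r) \<in> V" for q p r
    unfolding m_def using V that by (intro Max_ge) (auto intro!: image_eqI[where x = "(q,p,r)"])
  define N where "N = nat \<lceil>1/\<alpha>\<rceil> + nat \<lceil>1/\<beta>\<rceil> + nat \<lceil>1/\<gamma>\<rceil>"
  \<comment> \<open>The modulus must exceed \<open>2 * m\<close>, to separate the points of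
    \<open>V\<close> modulo \<open>M\<close>, and be so large that the dilated polar box has
    half-sides at least 1, as counting its integer points requires.\<close>
  define M where "M = nat (2 * m) + N + 1"
  have M0: "M > 0" by (simp add: M_def)
  have ge1: "M * z \<ge> 1" if "z > 0" "real M \<ge> nat \<lceil>1/z\<rceil>" for z :: real
  proof -
    have "1 / z \<le> M" using that by linarith
    then show ?thesis using that by (simp add: field_simps)
  qed
  have M1: "M * \<alpha> \<ge> 1" "M * \<beta> \<ge> 1" "M * \<gamma> \<ge> 1"
    by (intro ge1 pos; simp only: M_def N_def of_nat_le_iff)+
  have bound: "2 * \<bar>q\<bar> < int M \<and> 2 * \<bar>p\<bar> < int M \<and> 2 * \<bar>r\<bar> < int M" if "(q, p, r) \<in> V" for q p r
  proof -
    have "2 * m < int M" unfolding M_def by linarith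
    then show ?thesis using m[OF that] by linarith
  qed
  \<comment> \<open>\<open>G\<close> will be the set of integer points of the polar box dilated by
    \<open>M\<close>, chosen in the order \<open>c\<close>, \<open>b\<close>, \<open>a\<close>
    because the forms are triangular.\<close>
  define C where "C = {\<lceil>0 - M * \<gamma>\<rceil>..\<lfloor>0 + M * \<gamma>\<rfloor>}"
  define B where "B c = {\<lceil>- (c * s) - M * \<beta>\<rceil>..\<lfloor>- (c * s) + M * \<beta>\<rfloor>}" for c :: int
  define A where "A c b = {\<lceil>- (b * x + c * y) - M * \<alpha>\<rceil>..\<lfloor>- (b * x + c * y) + M * \<alpha>\<rfloor>}" for b c :: int
  define H where "H = Sigma C (\<lambda>c. Sigma (B c) (A c))"
  define G where "G = (\<lambda>(c,b,a). (a,b,c)) ` H"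
  have finH: "finite H" unfolding H_def C_def B_def A_def by (intro finite_SigmaI) auto
  then have finG: "finite G" by (simp add: G_def)
  have G: "\<bar>a + b * x + c * y\<bar> \<le> M * \<alpha> \<and> \<bar>b + c * s\<bar> \<le> M * \<beta> \<and> \<bar>real_of_int c\<bar> \<le> M * \<gamma>"
    if "(a,b,c) \<in> G" for a b c
    using that unfolding G_def H_def A_def B_def C_def
    by (auto simp: ceiling_le_iff le_floor_iff abs_le_iff)
  have cardG: "card G \<ge> real M ^ 3 * (\<alpha> * \<beta> * \<gamma>)"
  proof -
    have 1: "(\<Sum>b\<in>B c. real (card (A c b))) \<ge> (M * \<beta>) * (M * \<alpha>)" for c
    proof -
      have "(M * \<beta>) * (M * \<alpha>) \<le> card (B c) * (M * \<alpha>)"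
        using M1 unfolding B_def by (intro mult_right_mono card_int_interval_ge) auto
      also have "\<dots> = (\<Sum>b\<in>B c. M * \<alpha>)" by simp
      also have "\<dots> \<le> (\<Sum>b\<in>B c. real (card (A c b)))"
        using M1 unfolding A_def by (intro sum_mono card_int_interval_ge) auto
      finally show ?thesis .
    qed
    have "card G = card H"
      unfolding G_def by (rule card_image) (auto simp: inj_on_def)
    also have "\<dots> = (\<Sum>c\<in>C. \<Sum>b\<in>B c. card (A c b))"
      unfolding H_def by (simp add: C_def B_def A_def)
    finally have *: "real (card G) = (\<Sum>c\<in>C. \<Sum>b\<in>B c. real (card (A c b)))" by simp
    have "real M ^ 3 * (\<alpha> * \<beta> * \<gamma>) = (M * \<gamma>) * ((M * \<beta>) * (M * \<alpha>))"
      by (simp add: power3_eq_cube)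
    also have "\<dots> \<le> card C * ((M * \<beta>) * (M * \<alpha>))"
      using M1 pos unfolding C_def by (intro mult_right_mono card_int_interval_ge) auto
    also have "\<dots> = (\<Sum>c\<in>C. (M * \<beta>) * (M * \<alpha>))" by simp
    also have "\<dots> \<le> card G" unfolding * by (intro sum_mono 1)
    finally show ?thesis .
  qed
  \<comment> \<open>Points of \<open>G\<close> congruent modulo \<open>M\<close> differ by
    \<open>M\<close> times an integer point of the doubled polar box; \<open>no_dual\<close> leaves
    only 0.\<close>
  have inj: "inj_on (\<lambda>(a,b,c). (a mod int M, b mod int M, c mod int M)) G"
  proof (rule inj_onI)
    fix t t'
    assume t: "t \<in> G" "t' \<in> G"
      and eq: "(\<lambda>(a,b,c). (a mod int M, b mod int M, c mod int M)) t
        = (\<lambda>(a,b,c). (a mod int M, b mod int M, c mod int M)) t'"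
    obtain a b c a' b' c' where tt: "t = (a,b,c)" "t' = (a',b',c')" by (metis prod_cases3)
    have g: "(a,b,c) \<in> G" "(a',b',c') \<in> G" using t tt by auto
    have e: "a mod int M = a' mod int M" "b mod int M = b' mod int M" "c mod int M = c' mod int M"
      using eq tt by auto
    obtain k l n where k: "a - a' = int M * k" "b - b' = int M * l" "c - c' = int M * n"
      using e by (auto simp: mod_eq_dvd_iff dvd_def)
    have k': "real_of_int a - a' = M * k" "real_of_int b - b' = M * l" "real_of_int c - c' = M * n"
      using k by (metis of_int_diff of_int_mult of_int_of_nat_eq)+
    have le: "\<bar>w\<bar> \<le> 2 * z" if "M * w = A - B" "\<bar>A\<bar> \<le> M * z" "\<bar>B\<bar> \<le> M * z" for w z A B :: real
    proof -
      have "M * \<bar>w\<bar> = \<bar>M * w\<bar>" by (simp add: abs_mult)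
      also have "\<dots> = \<bar>A - B\<bar>" by (simp only: that(1))
      also have "\<dots> \<le> M * (2 * z)" using that by linarith
      finally show ?thesis using M0 by simp
    qed
    have "k = 0 \<and> l = 0 \<and> n = 0"
    proof (rule no_dual)
      have "M * (k + l * x + n * y) = (a + b * x + c * y) - (a' + b' * x + c' * y)"
        using k' by (simp add: algebra_simps)
      then show "\<bar>k + l * x + n * y\<bar> \<le> 2 * \<alpha>" using G[OF g(1)] G[OF g(2)] by (blast intro: le)
      have "M * (l + n * s) = (b + c * s) - (b' + c' * s)"
        using k' by (simp add: algebra_simps)
      then show "\<bar>l + n * s\<bar> \<le> 2 * \<beta>" using G[OF g(1)] G[OF g(2)] by (blast intro: le)
      have "M * real_of_int n = real_of_int c - real_of_int c'" using k'(3) by simp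
      then show "\<bar>real_of_int n\<bar> \<le> 2 * \<gamma>"
        using G[OF g(1)] G[OF g(2)] by (blast intro: le)
    qed
    then show "t = t'" using k tt by auto
  qed
  \<comment> \<open>The pairing of a point of \<open>V\<close> with a point of \<open>G\<close>
    splits into three products of dual coordinates, each at most \<open>M / 18\<close> in absolute
    value. Every phase is thus at most \<open>pi / 3\<close>, with cosine at least 1/2.\<close>
  have large: "(card V / 2)\<^sup>2 \<le> (cmod (\<Sum>(q,p,r)\<in>V. cis (2 * pi * (q * a + p * b + r * c) / M)))\<^sup>2"
    if t: "(a,b,c) \<in> G" for a b c
  proof -
    have half: "1/2 \<le> cos (2 * pi * (q * a + p * b + r * c) / M)" if v: "(q,p,r) \<in> V" for q p r
    proof -
      let ?l = "r - q * y - s * (p - q * x)"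
      have id: "real_of_int (q * a + p * b + r * c)
          = q * (a + b * x + c * y) + (p - q * x) * (b + c * s) + ?l * c"
        by (simp add: algebra_simps)
      have pr: "\<bar>u * w\<bar> \<le> M / 18" if "\<bar>u\<bar> * z \<le> 1/18" "\<bar>w\<bar> \<le> M * z" for u w z :: real
      proof -
        have "\<bar>u\<bar> * \<bar>w\<bar> \<le> \<bar>u\<bar> * (M * z)" using that by (intro mult_left_mono) auto
        also have "\<dots> \<le> M * (1/18)" using that(1) mult_left_mono[OF that(1), of M] by (simp add: mult_ac)
        finally show ?thesis by (simp add: abs_mult)
      qed
      have "\<bar>q * (a + b * x + c * y)\<bar> \<le> M / 18" "\<bar>(p - q * x) * (b + c * s)\<bar> \<le> M / 18" "\<bar>?l * c\<bar> \<le> M / 18"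
        by (rule pr; use box[OF v] G[OF t] in blast)+
      then have "\<bar>real_of_int (q * a + p * b + r * c)\<bar> \<le> M / 18 + M / 18 + M / 18"
        unfolding id by (rule abs_add3_le)
      then have "\<bar>real_of_int (q * a + p * b + r * c)\<bar> \<le> M / 6" by simp
      then have "2 * pi / M * \<bar>real_of_int (q * a + p * b + r * c)\<bar> \<le> 2 * pi / M * (M / 6)"
        by (rule mult_left_mono) simp
      moreover have "\<bar>2 * pi * real_of_int (q * a + p * b + r * c) / M\<bar>
          = 2 * pi / M * \<bar>real_of_int (q * a + p * b + r * c)\<bar>"
        by (simp only: abs_mult abs_divide) simp
      ultimately have "\<bar>2 * pi * real_of_int (q * a + p * b + r * c) / M\<bar> \<le> pi / 3"
        using M0 by simp
      then have "cos (pi / 3) \<le> cos \<bar>2 * pi * real_of_int (q * a + p * b + r * c) / M\<bar>"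
        by (intro cos_monotone_0_pi_le) auto
      then show ?thesis by (simp only: cos_abs_real cos_60)
    qed
    have "card V / 2 = (\<Sum>v\<in>V. 1/2)" by simp
    also have "\<dots> \<le> (\<Sum>(q,p,r)\<in>V. cos (2 * pi * (q * a + p * b + r * c) / M))"
      by (rule sum_mono) (use half in auto)
    also have "\<dots> = Re (\<Sum>(q,p,r)\<in>V. cis (2 * pi * (q * a + p * b + r * c) / M))"
      by (simp add: split_def)
    also have "\<dots> \<le> cmod (\<Sum>(q,p,r)\<in>V. cis (2 * pi * (q * a + p * b + r * c) / M))"
      by (rule complex_Re_le_cmod)
    finally show ?thesis by (intro power_mono) auto
  qed
  have "real M ^ 3 * (\<alpha> * \<beta> * \<gamma>) * (card V / 2)\<^sup>2 \<le> card G * (card V / 2)\<^sup>2"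
    by (rule mult_right_mono[OF cardG]) simp
  also have "\<dots> = (\<Sum>t\<in>G. (card V / 2)\<^sup>2)" by simp
  also have "\<dots> \<le> (\<Sum>(a,b,c)\<in>G. (cmod (\<Sum>(q,p,r)\<in>V. cis (2 * pi * (q * a + p * b + r * c) / M)))\<^sup>2)"
    by (rule sum_mono) (use large in auto)
  also have "\<dots> \<le> real M ^ 3 * card V"
    by (rule sum_trig_poly_packing[OF M0 V finG bound inj])
  finally have "(card V * (\<alpha> * \<beta> * \<gamma>)) * (real M ^ 3 * card V) \<le> 4 * (real M ^ 3 * card V)"
    by (simp add: power2_eq_square field_simps)
  then show ?thesis
    using M0 by (cases "card V = 0") (simp_all add: mult_le_cancel_right)
qed

text \<open>The bound for finite sets is uniform over the finite subsets of \<open>V\<close>, which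
  forces \<open>V\<close> itself to be finite.\<close>

lemma lattice_count:
  fixes x y s \<alpha> \<beta> \<gamma> :: real and V :: "(int \<times> int \<times> int) set"
  assumes pos: "\<alpha> > 0" "\<beta> > 0" "\<gamma> > 0"
    and box: "\<And>q p r. (q, p, r) \<in> V \<Longrightarrow>
       \<bar>real_of_int q\<bar> * \<alpha> \<le> 1/18 \<and> \<bar>p - q * x\<bar> * \<beta> \<le> 1/18 \<and> \<bar>r - q * y - s * (p - q * x)\<bar> * \<gamma> \<le> 1/18"
    and no_dual: "\<And>(a::int) (b::int) (c::int). \<bar>a + b * x + c * y\<bar> \<le> 2 * \<alpha> \<Longrightarrow> \<bar>b + c * s\<bar> \<le> 2 * \<beta> \<Longrightarrow>
       \<bar>real_of_int c\<bar> \<le> 2 * \<gamma> \<Longrightarrow> a = 0 \<and> b = 0 \<and> c = 0"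
  shows "finite V \<and> card V \<le> 4 / (\<alpha> * \<beta> * \<gamma>)"
proof -
  have abc: "\<alpha> * \<beta> * \<gamma> > 0" using pos by simp
  have *: "card W \<le> nat \<lfloor>4 / (\<alpha> * \<beta> * \<gamma>)\<rfloor>" if "W \<subseteq> V" "finite W" for W
  proof -
    have "card W * (\<alpha> * \<beta> * \<gamma>) \<le> 4"
      by (rule lattice_count_finite[OF that(2) pos _ no_dual]) (use box that in auto)
    then have "real (card W) \<le> 4 / (\<alpha> * \<beta> * \<gamma>)" using abc by (simp add: pos_le_divide_eq)
    then show ?thesis by (simp add: le_nat_floor)
  qed
  have "finite V \<and> card V \<le> nat \<lfloor>4 / (\<alpha> * \<beta> * \<gamma>)\<rfloor>"
    by (rule finite_if_finite_subsets_card_bdd) (use * in auto)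
  moreover have "real (nat \<lfloor>4 / (\<alpha> * \<beta> * \<gamma>)\<rfloor>) \<le> 4 / (\<alpha> * \<beta> * \<gamma>)"
    using abc by (intro of_nat_floor) simp
  ultimately show ?thesis by linarith
qed

section \<open>Special points of a curved arc\<close>

lemma abs_cross_le:
  fixes a b c d :: real
  assumes "\<bar>a\<bar> \<le> A" "\<bar>b\<bar> \<le> B" "\<bar>c\<bar> \<le> C" "\<bar>d\<bar> \<le> D"
  shows "\<bar>a * b - c * d\<bar> \<le> A * B + C * D"
proof -
  have "\<bar>a * b\<bar> \<le> A * B" "\<bar>c * d\<bar> \<le> C * D"
    unfolding abs_mult using assms by (intro mult_mono; linarith)+
  then show ?thesis by linarith
qed

text \<open>All constants are uniform on the compact arc. The fixed sign in \<open>curved\<close>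
  makes each \<open>a + b * x + c * f x\<close> with a nonzero integer \<open>c\<close> uniformly
  convex or uniformly concave.\<close>

locale curved_arc =
  fixes f f' f'' :: "real \<Rightarrow> real" and u v m M c1 c2 :: real
  assumes uv: "u < v" and m: "0 < m" and M: "0 \<le> M" and c1: "0 < c1" and c2: "0 < c2"
    and d1: "\<And>x. x \<in> {u..v} \<Longrightarrow> (f has_real_derivative f' x) (at x)"
    and d2: "\<And>x. x \<in> {u..v} \<Longrightarrow> (f' has_real_derivative f'' x) (at x)"
    and f'_bounds: "\<And>x. x \<in> {u..v} \<Longrightarrow> c2 \<le> f' x \<and> f' x \<le> c1"
    and f''_bound: "\<And>x. x \<in> {u..v} \<Longrightarrow> \<bar>f'' x\<bar> \<le> M"
    and curved: "(\<forall>x\<in>{u..v}. m \<le> f'' x) \<or> (\<forall>x\<in>{u..v}. f'' x \<le> - m)"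

text \<open>The form of the rational line \<open>a + b * x + c * y = 0\<close> evaluated along the
  arc. Together with its derivative \<open>F'\<close> it measures how far the line is from being
  tangent at \<open>x\<close>.\<close>

definition F :: "(real \<Rightarrow> real) \<Rightarrow> int \<Rightarrow> int \<Rightarrow> int \<Rightarrow> real \<Rightarrow> real" where
  "F f a b c x = a + b * x + c * f x"

definition F' :: "(real \<Rightarrow> real) \<Rightarrow> int \<Rightarrow> int \<Rightarrow> real \<Rightarrow> real" where
  "F' f' b c x = b + c * f' x"

section \<open>Mean value and Taylor estimates along the arc\<close>

lemma mvt_f:
  fixes f f' f'' :: "real \<Rightarrow> real" and u v m M c1 c2 :: real
  assumes arc: "curved_arc f f' f'' u v m M c1 c2" and pts: "x \<in> {u..v}" "y \<in> {u..v}"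
  shows "\<exists>z\<in>{u..v}. \<bar>z - y\<bar> \<le> \<bar>x - y\<bar> \<and> f x - f y = (x - y) * f' z"
proof -
  interpret curved_arc f f' f'' u v m M c1 c2 by (rule arc)
  have *: "\<exists>z\<in>{x..y}. f y - f x = (y - x) * f' z" if xy: "u \<le> x" "x < y" "y \<le> v" for x y
  proof -
    have "\<exists>z>x. z < y \<and> f y - f x = (y - x) * f' z"
      using xy by (intro MVT2) (auto intro: d1)
    then show ?thesis by (auto intro: less_imp_le)
  qed
  consider "x = y" | "x < y" | "y < x" by linarith
  then show ?thesis
  proof cases
    case 2
    then obtain z where "z \<in> {x..y}" "f y - f x = (y - x) * f' z" using *[of x y] \<open>x \<in> _\<close> \<open>y \<in> _\<close> by auto
    then show ?thesis using \<open>x \<in> _\<close> \<open>y \<in> _\<close> by (intro bexI[of _ z]) (auto simp: algebra_simps)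
  next
    case 3
    then obtain z where "z \<in> {y..x}" "f x - f y = (x - y) * f' z" using *[of y x] \<open>x \<in> _\<close> \<open>y \<in> _\<close> by auto
    then show ?thesis using \<open>x \<in> _\<close> \<open>y \<in> _\<close> by (intro bexI[of _ z]) (auto simp: algebra_simps)
  qed (use \<open>y \<in> _\<close> in auto)
qed

lemma mvt_f':
  fixes f f' f'' :: "real \<Rightarrow> real" and u v m M c1 c2 :: real
  assumes arc: "curved_arc f f' f'' u v m M c1 c2" and pts: "u \<le> x" "x \<le> y" "y \<le> v"
  shows "\<exists>z\<in>{u..v}. f' y - f' x = (y - x) * f'' z"
proof -
  interpret curved_arc f f' f'' u v m M c1 c2 by (rule arc)
  show ?thesis
  proof (cases "x = y")
    case False
    then have "\<exists>z>x. z < y \<and> f' y - f' x = (y - x) * f'' z"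
      using pts by (intro MVT2) (auto intro: d2)
    then show ?thesis using pts by (meson atLeastAtMost_iff less_imp_le order_trans)
  qed (use pts in auto)
qed

lemma f'_lipschitz:
  fixes f f' f'' :: "real \<Rightarrow> real" and u v m M c1 c2 :: real
  assumes arc: "curved_arc f f' f'' u v m M c1 c2" and pts: "x \<in> {u..v}" "y \<in> {u..v}"
  shows "\<bar>f' x - f' y\<bar> \<le> M * \<bar>x - y\<bar>"
proof -
  interpret curved_arc f f' f'' u v m M c1 c2 by (rule arc)
  have *: "\<bar>f' y - f' x\<bar> \<le> M * \<bar>y - x\<bar>" if xy: "u \<le> x" "x \<le> y" "y \<le> v" for x y
  proof -
    obtain z where z: "z \<in> {u..v}" "f' y - f' x = (y - x) * f'' z" using mvt_f'[OF arc xy] by blast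
    have "\<bar>f'' z\<bar> * \<bar>y - x\<bar> \<le> M * \<bar>y - x\<bar>" using f''_bound[OF z(1)] by (rule mult_right_mono) simp
    then show ?thesis using z(2) by (simp add: abs_mult mult.commute)
  qed
  show ?thesis
    using *[of x y] *[of y x] pts by (cases "x \<le> y") (auto simp: abs_minus_commute)
qed

lemma f_taylor:
  fixes f f' f'' :: "real \<Rightarrow> real" and u v m M c1 c2 :: real
  assumes arc: "curved_arc f f' f'' u v m M c1 c2" and xy: "x \<in> {u..v}" "y \<in> {u..v}"
  shows "\<bar>f x - f y - f' y * (x - y)\<bar> \<le> M * \<bar>x - y\<bar>\<^sup>2"
proof -
  interpret curved_arc f f' f'' u v m M c1 c2 by (rule arc)
  obtain z where z: "z \<in> {u..v}" "\<bar>z - y\<bar> \<le> \<bar>x - y\<bar>" "f x - f y = (x - y) * f' z"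
    using mvt_f[OF arc xy] by blast
  have "\<bar>f' z - f' y\<bar> \<le> M * \<bar>x - y\<bar>"
    using f'_lipschitz[OF arc z(1) xy(2)] mult_left_mono[OF z(2) M] by linarith
  then have "\<bar>x - y\<bar> * \<bar>f' z - f' y\<bar> \<le> \<bar>x - y\<bar> * (M * \<bar>x - y\<bar>)"
    by (rule mult_left_mono) simp
  moreover have "f x - f y - f' y * (x - y) = (x - y) * (f' z - f' y)"
    using z(3) by (simp add: algebra_simps)
  ultimately show ?thesis by (simp add: abs_mult power2_eq_square mult_ac)
qed

text \<open>Taylor expansion of \<open>F\<close> at \<open>y\<close>, whose remainder is
  \<open>c\<close> times that of \<open>f\<close>. A line nearly tangent at one point thereby stays
  under control in a whole window.\<close>

lemma F_transport:
  fixes f f' f'' :: "real \<Rightarrow> real" and u v m M c1 c2 :: real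
  assumes arc: "curved_arc f f' f'' u v m M c1 c2"
    and xy: "x \<in> {u..v}" "y \<in> {u..v}" "\<bar>x - y\<bar> \<le> l"
    and y: "\<bar>F f a b c y\<bar> \<le> \<tau>" "\<bar>F' f' b c y\<bar> \<le> \<epsilon>" and c: "\<bar>real_of_int c\<bar> \<le> B"
  shows "\<bar>F' f' b c x\<bar> \<le> \<epsilon> + B * (M * l)" "\<bar>F f a b c x\<bar> \<le> \<tau> + \<epsilon> * l + B * (M * l\<^sup>2)"
proof -
  interpret curved_arc f f' f'' u v m M c1 c2 by (rule arc)
  have "\<bar>f' x - f' y\<bar> \<le> M * l"
    using f'_lipschitz[OF arc xy(1,2)] mult_left_mono[OF xy(3) M] by linarith
  then have "\<bar>c * (f' x - f' y)\<bar> \<le> B * (M * l)"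
    unfolding abs_mult using c by (intro mult_mono) auto
  moreover have "F' f' b c x = F' f' b c y + c * (f' x - f' y)"
    by (simp add: F'_def algebra_simps)
  ultimately show "\<bar>F' f' b c x\<bar> \<le> \<epsilon> + B * (M * l)" using y by linarith
  have "\<bar>x - y\<bar>\<^sup>2 \<le> l\<^sup>2" using xy by (intro power_mono) auto
  then have "\<bar>f x - f y - f' y * (x - y)\<bar> \<le> M * l\<^sup>2"
    using f_taylor[OF arc xy(1,2)] mult_left_mono[of "\<bar>x - y\<bar>\<^sup>2" "l\<^sup>2" M] M by linarith
  then have "\<bar>c * (f x - f y - f' y * (x - y))\<bar> \<le> B * (M * l\<^sup>2)"
    unfolding abs_mult using c by (intro mult_mono) auto
  moreover have "\<bar>F' f' b c y * (x - y)\<bar> \<le> \<epsilon> * l"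
    unfolding abs_mult using y xy by (intro mult_mono) auto
  moreover have "F f a b c x = F f a b c y + F' f' b c y * (x - y) + c * (f x - f y - f' y * (x - y))"
    by (simp add: F_def F'_def algebra_simps)
  ultimately show "\<bar>F f a b c x\<bar> \<le> \<tau> + \<epsilon> * l + B * (M * l\<^sup>2)" using y(1) by (simp only: abs_add3_le)
qed

text \<open>The second derivative \<open>c * f''\<close> of \<open>F\<close> has constant sign and
  size at least \<open>m * \<bar>c\<bar>\<close>, so the sublevel estimate applies once the sign is
  normalised by \<open>\<sigma>\<close>.\<close>

lemma outer_le_F_small:
  fixes f f' f'' :: "real \<Rightarrow> real" and u v m M c1 c2 :: real
  assumes arc: "curved_arc f f' f'' u v m M c1 c2"
    and c: "c \<noteq> 0" and g: "g > 0" "\<tau> \<le> m * \<bar>real_of_int c\<bar> * g\<^sup>2"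
  shows "outer_le {x \<in> {u..v}. \<bar>F f a b c x\<bar> \<le> \<tau>} (12 * g)"
proof -
  interpret curved_arc f f' f'' u v m M c1 c2 by (rule arc)
  define \<sigma> :: real where "\<sigma> = (if \<forall>x\<in>{u..v}. m \<le> f'' x then 1 else -1) * sgn (real_of_int c)"
  have \<sigma>: "\<bar>\<sigma>\<bar> = 1" using c by (simp add: \<sigma>_def abs_mult abs_sgn_eq)
  have curv: "m * \<bar>real_of_int c\<bar> \<le> \<sigma> * c * f'' x" if "x \<in> {u..v}" for x
  proof -
    have "\<sigma> * c = (if \<forall>x\<in>{u..v}. m \<le> f'' x then 1 else -1) * \<bar>real_of_int c\<bar>"
      by (simp add: \<sigma>_def abs_sgn mult_ac)
    then show ?thesis
      using curved that by (auto simp: mult.commute[of m] intro!: mult_left_mono split: if_splits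
          dest!: bspec[of _ _ x])
         (metis abs_ge_zero minus_mult_right mult_left_mono neg_le_iff_le minus_minus le_minus_iff)
  qed
  have "outer_le {x \<in> {u..v}. \<bar>\<sigma> * F f a b c x\<bar> \<le> \<tau>} (12 * g)"
  proof (rule outer_le_sublevel)
    fix x assume "x \<in> {u..v}"
    then show "((\<lambda>x. \<sigma> * F f a b c x) has_real_derivative \<sigma> * F' f' b c x) (at x)"
      unfolding F_def F'_def by (auto intro!: derivative_eq_intros d1)
  next
    fix x y assume xy: "u \<le> x" "x \<le> y" "y \<le> v"
    then obtain z where z: "z \<in> {u..v}" "f' y - f' x = (y - x) * f'' z" using mvt_f'[OF arc] by blast
    have "m * \<bar>real_of_int c\<bar> * (y - x) \<le> \<sigma> * c * f'' z * (y - x)"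
      using curv[OF z(1)] xy by (intro mult_right_mono) auto
    also have "\<dots> = \<sigma> * c * (f' y - f' x)" using z by simp
    also have "\<dots> = \<sigma> * F' f' b c y - \<sigma> * F' f' b c x" by (simp add: F'_def algebra_simps)
    finally show "m * \<bar>real_of_int c\<bar> * (y - x) \<le> \<sigma> * F' f' b c y - \<sigma> * F' f' b c x" .
  qed (use c g m in auto)
  then show ?thesis by (simp add: abs_mult \<sigma>)
qed

text \<open>The parameter is \<open>s = Q powr (1/40)\<close>. The bounds are \<open>1 / Q\<close> and, for the smallest admissible
  \<open>\<delta> = 1 / s ^ 22\<close>, the quantities \<open>1 / sqrt (\<delta> * Q)\<close> and \<open>1 / \<delta>\<close>.\<close>

definition special :: "(real \<Rightarrow> real) \<Rightarrow> (real \<Rightarrow> real) \<Rightarrow> real \<Rightarrow> real \<Rightarrow> real \<Rightarrow> real set" where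
  "special f f' u v s = {x \<in> {u..v}. \<exists>a b c. \<not> (a = 0 \<and> b = 0 \<and> c = 0) \<and>
     \<bar>F f a b c x\<bar> \<le> 1 / s ^ 40 \<and> \<bar>F' f' b c x\<bar> \<le> 1 / s ^ 9 \<and> \<bar>real_of_int c\<bar> \<le> s ^ 22}"

definition level :: "(real \<Rightarrow> real) \<Rightarrow> (real \<Rightarrow> real) \<Rightarrow> real \<Rightarrow> real \<Rightarrow> real \<Rightarrow> real \<Rightarrow> real set" where
  "level f f' u v s B = {x \<in> {u..v}. \<exists>a b c. B \<le> \<bar>real_of_int c\<bar> \<and> \<bar>real_of_int c\<bar> \<le> 2 * B \<and>
     \<bar>F f a b c x\<bar> \<le> 1 / s ^ 40 \<and> \<bar>F' f' b c x\<bar> \<le> 1 / s ^ 9}"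

text \<open>The bounds are those that \<open>level_parallel\<close> finds for the intersection of
  two lines. Denominators up to order \<open>s ^ 14\<close> with error of order
  \<open>1 / s ^ 16\<close> give total measure of order \<open>1 / s ^ 2\<close>.\<close>

definition approximable :: "real \<Rightarrow> real \<Rightarrow> real \<Rightarrow> real \<Rightarrow> real set" where
  "approximable u v M s = {x \<in> {u..v}. \<exists>(q::int) (p::int). q \<noteq> 0 \<and> \<bar>real_of_int q\<bar> \<le> 4 * (1 + M) * s ^ 14 \<and>
     \<bar>p - q * x\<bar> \<le> (6 + 4 * M) / s ^ 16}"

text \<open>Two coordinates of the cross product of \<open>(a, b, c)\<close> and \<open>(a', b', c')\<close>, the rational point
  common to both lines. They are small when both lines are nearly tangent to the arc at \<open>x\<close>.\<close>

lemma cross_product_coordinates: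
  "real_of_int (b * c' - c * b') = F' f' b c x * c' - c * F' f' b' c' x"
  "real_of_int (c * a' - a * c') - real_of_int (b * c' - c * b') * x = c * F f a' b' c' x - c' * F f a b c x"
  unfolding F_def F'_def by (simp_all add: algebra_simps)

text \<open>Moved from \<open>y\<close> to \<open>x\<close>, the first line is still nearly tangent,
  so the cross product of the two lines gives integers \<open>q\<close> and \<open>p\<close> with
  \<open>p - q * x\<close> tiny. As \<open>x\<close> is not approximable, both vanish. The lines
  then coincide, and the bound for the second passes to the first with a factor 2 from the ratio of
  \<open>c\<close> and \<open>c'\<close>.\<close>

lemma level_parallel:
  fixes f f' f'' :: "real \<Rightarrow> real" and u v m M c1 c2 :: real
  assumes arc: "curved_arc f f' f'' u v m M c1 c2"
    and s: "s \<ge> 1" "s ^ 16 > 6 + 4 * M" and B: "1 \<le> B" "B \<le> s ^ 22"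
    and x: "x \<in> {u..v}" "x \<notin> approximable u v M s" and y: "y \<in> {u..v}" "\<bar>x - y\<bar> \<le> 1 / (s ^ 8 * B)"
    and c: "B \<le> \<bar>real_of_int c\<bar>" "\<bar>real_of_int c\<bar> \<le> 2 * B"
    and F: "\<bar>F f a b c y\<bar> \<le> 1 / s ^ 40" "\<bar>F' f' b c y\<bar> \<le> 1 / s ^ 9"
    and c': "B \<le> \<bar>real_of_int c'\<bar>" "\<bar>real_of_int c'\<bar> \<le> 2 * B"
    and F': "\<bar>F f a' b' c' x\<bar> \<le> 1 / s ^ 40" "\<bar>F' f' b' c' x\<bar> \<le> 1 / s ^ 9"
  shows "\<bar>F f a b c x\<bar> \<le> 2 / s ^ 40"
proof -
  interpret curved_arc f f' f'' u v m M c1 c2 by (rule arc)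
  define t where "t = 1 / s"
  have t: "0 < t" "t \<le> 1" using s by (auto simp: t_def)
  have inv: "1 / s ^ n = t ^ n" for n by (simp add: t_def power_one_over)
  define \<kappa> where "\<kappa> = 1 / B"
  have \<kappa>: "0 < \<kappa>" "\<kappa> \<le> 1" "B * \<kappa> = 1" using B by (auto simp: \<kappa>_def)
  have tB: "t ^ 22 * B \<le> 1" using B(2) s by (simp add: t_def power_one_over field_simps)
  have y2: "\<bar>x - y\<bar> \<le> t ^ 8 * \<kappa>" using y(2) by (simp add: \<kappa>_def t_def power_one_over)
  have tp: "t ^ n \<le> t ^ k" if "k \<le> n" for n k using t that by (intro power_decreasing) auto
  have Fx: "\<bar>F' f' b c x\<bar> \<le> t ^ 9 + 2 * B * (M * (t ^ 8 * \<kappa>))"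
    "\<bar>F f a b c x\<bar> \<le> t ^ 40 + t ^ 9 * (t ^ 8 * \<kappa>) + 2 * B * (M * (t ^ 8 * \<kappa>)\<^sup>2)"
    using F_transport[OF arc x(1) y(1) y2 _ _ c(2), of a b "t ^ 40" "t ^ 9"] F by (auto simp: inv)
  have G: "\<bar>F' f' b c x\<bar> \<le> (1 + 2 * M) * t ^ 8"
  proof -
    have "t ^ 9 + 2 * B * (M * (t ^ 8 * \<kappa>)) = t ^ 9 + 2 * M * t ^ 8 * (B * \<kappa>)" by (simp add: mult_ac)
    also have "\<dots> \<le> t ^ 8 + 2 * M * t ^ 8" unfolding \<kappa>(3) using tp[of 8 9] by simp
    finally show ?thesis using Fx(1) by (simp add: algebra_simps)
  qed
  have H: "B * \<bar>F f a b c x\<bar> \<le> (2 + 2 * M) * t ^ 16"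
  proof -
    have "B * \<bar>F f a b c x\<bar> \<le> B * (t ^ 40 + t ^ 9 * (t ^ 8 * \<kappa>) + 2 * B * (M * (t ^ 8 * \<kappa>)\<^sup>2))"
      using Fx(2) B by (intro mult_left_mono) auto
    also have "\<dots> = t ^ 22 * B * t ^ 18 + t ^ 17 * (B * \<kappa>) + 2 * M * t ^ 16 * (B * \<kappa>)\<^sup>2"
      by (simp add: algebra_simps power2_eq_square power_mult_distrib flip: power_add)
    also have "\<dots> \<le> 1 * t ^ 18 + t ^ 17 + 2 * M * t ^ 16"
      unfolding \<kappa>(3) using tB t by (intro add_mono mult_right_mono) auto
    also have "\<dots> \<le> (2 + 2 * M) * t ^ 16" using tp[of 16 17] tp[of 16 18] by (simp add: algebra_simps)
    finally show ?thesis .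
  qed
  have t16: "(6 + 4 * M) * t ^ 16 < 1" using s by (simp add: t_def power_one_over field_simps)
  define q p where "q = b * c' - c * b'" and "p = c * a' - a * c'"
  have q_le: "\<bar>real_of_int q\<bar> \<le> 4 * (1 + M) * s ^ 14"
  proof -
    have "\<bar>real_of_int q\<bar> \<le> (1 + 2 * M) * t ^ 8 * (2 * B) + 2 * B * t ^ 9"
      unfolding q_def cross_product_coordinates(1)[of _ _ _ _ f' x]
      using abs_cross_le[OF G c'(2) c(2) F'(2)[unfolded inv]] .
    also have "\<dots> \<le> (1 + 2 * M) * t ^ 8 * (2 * B) + 2 * B * t ^ 8"
      using tp[of 8 9] B by simp
    also have "\<dots> = 4 * (1 + M) * (t ^ 8 * B)" by (simp add: algebra_simps)
    also have "\<dots> \<le> 4 * (1 + M) * s ^ 14"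
    proof (rule mult_left_mono)
      have "t ^ 8 * B \<le> t ^ 8 * s ^ 22" using B t by simp
      also have "\<dots> = s ^ 14" using s by (simp add: t_def field_simps flip: power_add)
      finally show "t ^ 8 * B \<le> s ^ 14" .
    qed (use M in simp)
    finally show ?thesis .
  qed
  have p_le: "\<bar>p - q * x\<bar> \<le> (6 + 4 * M) * t ^ 16"
  proof -
    have "\<bar>p - q * x\<bar> \<le> 2 * B * t ^ 40 + 2 * B * \<bar>F f a b c x\<bar>"
      unfolding p_def q_def cross_product_coordinates(2)[where f = f]
      using abs_cross_le[OF c(2) F'(1)[unfolded inv] c'(2) order_refl] .
    also have "2 * B * t ^ 40 = 2 * (t ^ 22 * B) * t ^ 18" by (simp add: mult_ac flip: power_add)
    also have "\<dots> \<le> 2 * 1 * t ^ 18" using tB t by (intro mult_right_mono mult_left_mono) auto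
    finally show ?thesis using H tp[of 16 18] by (simp add: algebra_simps)
  qed
  have "q = 0"
  proof (rule ccontr)
    assume "q \<noteq> 0"
    moreover have "\<bar>p - q * x\<bar> \<le> (6 + 4 * M) / s ^ 16" using p_le inv[of 16] by (simp add: divide_inverse)
    ultimately show False using x q_le unfolding approximable_def by blast
  qed
  \<comment> \<open>With \<open>q = 0\<close> the integer \<open>p\<close> has absolute value below
    1; this is where \<open>s ^ 16 > 6 + 4 * M\<close> enters.\<close>
  then have "p = 0" using p_le t16 by simp
  moreover have "p - q * x = c * F f a' b' c' x - c' * F f a b c x"
    unfolding p_def q_def by (rule cross_product_coordinates(2))
  ultimately have "c' * F f a b c x = c * F f a' b' c' x" using \<open>q = 0\<close> by simp
  then have "\<bar>real_of_int c'\<bar> * \<bar>F f a b c x\<bar> = \<bar>real_of_int c\<bar> * \<bar>F f a' b' c' x\<bar>"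
    by (metis abs_mult)
  also have "\<dots> \<le> 2 * B * t ^ 40" using c F'(1) unfolding inv by (intro mult_mono) auto
  finally have "B * \<bar>F f a b c x\<bar> \<le> 2 * B * t ^ 40"
    using mult_right_mono[OF c'(1), of "\<bar>F f a b c x\<bar>"] by simp
  then have "\<bar>F f a b c x\<bar> \<le> 2 * t ^ 40" using B by simp
  then show ?thesis by (simp add: t_def power_one_over)
qed

text \<open>In a window of length \<open>l\<close> all lines that matter are proportional to a
  single one, whose set of small values costs \<open>12 * g\<close>. About \<open>s ^ 8 * B\<close>
  windows with \<open>g\<close> of order \<open>1 / (s ^ 20 * sqrt B)\<close> give
  \<open>sqrt B / s ^ 12\<close>, and \<open>B \<le> s ^ 22\<close> turns this into
  \<open>1 / s\<close>.\<close>

lemma outer_le_level: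
  fixes f f' f'' :: "real \<Rightarrow> real" and u v m M c1 c2 :: real
  assumes arc: "curved_arc f f' f'' u v m M c1 c2"
    and s: "s \<ge> 1" "s ^ 16 > 6 + 4 * M" and B: "1 \<le> B" "B \<le> s ^ 22"
  shows "outer_le (level f f' u v s B - approximable u v M s) (12 * (v - u + 1) * sqrt (2 / m) / s)"
proof -
  interpret curved_arc f f' f'' u v m M c1 c2 by (rule arc)
  define l where "l = 1 / (s ^ 8 * B)"
  \<comment> \<open>Chosen so that \<open>m * B * g ^ 2 = 2 / s ^ 40\<close>, the threshold supplied
    by \<open>level_parallel\<close>.\<close>
  define g where "g = sqrt (2 / m) / (s ^ 20 * sqrt B)"
  have l: "l > 0" using s B by (simp add: l_def)
  have g: "g > 0" using s B m by (simp add: g_def)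
  have g2: "g\<^sup>2 = 2 / (m * B * s ^ 40)"
    using m B s by (simp add: g_def power_divide power_mult_distrib flip: power_mult)
  have each: "outer_le ((level f f' u v s B - approximable u v M s) \<inter> {t..t + l}) (12 * g)" for t
  proof (cases "(level f f' u v s B - approximable u v M s) \<inter> {t..t + l} = {}")
    case True
    then show ?thesis using g by (simp add: outer_le_empty)
  next
    case False
    then obtain y where y: "y \<in> level f f' u v s B" "y \<in> {t..t + l}" by blast
    then obtain a b c where abc: "y \<in> {u..v}" "B \<le> \<bar>real_of_int c\<bar>" "\<bar>real_of_int c\<bar> \<le> 2 * B"
       "\<bar>F f a b c y\<bar> \<le> 1 / s ^ 40" "\<bar>F' f' b c y\<bar> \<le> 1 / s ^ 9"
      unfolding level_def by blast
    have "2 / s ^ 40 = m * B * g\<^sup>2" using m B s by (simp add: g2)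
    also have "\<dots> \<le> m * \<bar>real_of_int c\<bar> * g\<^sup>2" using abc m by (intro mult_right_mono mult_left_mono) auto
    finally have "outer_le {x \<in> {u..v}. \<bar>F f a b c x\<bar> \<le> 2 / s ^ 40} (12 * g)"
      using abc B g by (intro outer_le_F_small[OF arc]) auto
    moreover have "(level f f' u v s B - approximable u v M s) \<inter> {t..t + l} \<subseteq> {x \<in> {u..v}. \<bar>F f a b c x\<bar> \<le> 2 / s ^ 40}"
    proof
      fix x assume x: "x \<in> (level f f' u v s B - approximable u v M s) \<inter> {t..t + l}"
      then obtain a' b' c' where abc': "x \<in> {u..v}" "B \<le> \<bar>real_of_int c'\<bar>" "\<bar>real_of_int c'\<bar> \<le> 2 * B"
         "\<bar>F f a' b' c' x\<bar> \<le> 1 / s ^ 40" "\<bar>F' f' b' c' x\<bar> \<le> 1 / s ^ 9"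
        unfolding level_def by blast
      have "\<bar>x - y\<bar> \<le> 1 / (s ^ 8 * B)" using x y(2) by (auto simp: l_def abs_le_iff)
      then show "x \<in> {x \<in> {u..v}. \<bar>F f a b c x\<bar> \<le> 2 / s ^ 40}"
        using level_parallel[OF arc s B abc'(1) _ abc(1) _ abc(2-5) abc'(2-5)] x abc'(1) by blast
    qed
    ultimately show ?thesis by (rule outer_le_mono) simp
  qed
  have "outer_le (level f f' u v s B - approximable u v M s) (((v - u) / l + 1) * (12 * g))"
    by (rule outer_le_partition[OF l _ _ _ each]) (use g uv in \<open>auto simp: level_def\<close>)
  moreover have "((v - u) / l + 1) * (12 * g) \<le> 12 * (v - u + 1) * sqrt (2 / m) / s"
  proof -
    have sB: "sqrt B \<le> s ^ 11"
      using B(2) s by (intro real_le_lsqrt) (auto simp flip: power_mult)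
    have "(v - u) / l + 1 \<le> (v - u + 1) * (s ^ 8 * B)"
      using B s by (simp add: l_def algebra_simps mult_ge1_I)
    then have "((v - u) / l + 1) * (12 * g) \<le> (v - u + 1) * (s ^ 8 * B) * (12 * g)"
      using g by (intro mult_right_mono) auto
    also have "\<dots> = 12 * (v - u + 1) * sqrt (2 / m) * (sqrt B / s ^ 12)"
    proof -
      have "s ^ 8 * B * g = sqrt (2 / m) * (sqrt B / s ^ 12)"
      proof -
        have "s ^ 20 = s ^ 12 * s ^ 8" by (simp flip: power_add)
        moreover have "B = sqrt B * sqrt B" using B by simp
        ultimately show ?thesis using s B unfolding g_def by (simp add: field_simps)
      qed
      moreover have "(v - u + 1) * (s ^ 8 * B) * (12 * g) = 12 * (v - u + 1) * (s ^ 8 * B * g)"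
        by (simp only: mult_ac)
      ultimately show ?thesis by (simp only: mult.assoc)
    qed
    also have "\<dots> \<le> 12 * (v - u + 1) * sqrt (2 / m) * (1 / s)"
    proof (rule mult_left_mono)
      have "sqrt B / s ^ 12 \<le> s ^ 11 / s ^ 12" using sB s by (intro divide_right_mono) auto
      also have "\<dots> = 1 / s" using s by (simp add: field_simps flip: power_Suc)
      finally show "sqrt B / s ^ 12 \<le> 1 / s" .
    qed (use uv m in simp)
    finally show ?thesis by simp
  qed
  ultimately show ?thesis by (rule outer_le_mono[OF _ order_refl])
qed

text \<open>Off the approximable points the set is covered by the levels \<open>B = 2 ^ n\<close>
  with \<open>2 ^ n \<le> s ^ 22\<close>: at most \<open>N + 1\<close> of them, each of measure
  \<open>O(1 / s)\<close>.\<close>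

lemma outer_le_special:
  fixes f f' f'' :: "real \<Rightarrow> real" and u v m M c1 c2 :: real
  assumes arc: "curved_arc f f' f'' u v m M c1 c2"
    and s: "s > 1" "s ^ 16 > 6 + 4 * M" and N: "s ^ 22 \<le> 2 ^ N"
  shows "outer_le (special f f' u v s) ((16 * (1 + M) * (6 + 4 * M) * (v - u + 3)
           + (real N + 1) * (12 * (v - u + 1) * sqrt (2 / m))) / s)"
proof -
  interpret curved_arc f f' f'' u v m M c1 c2 by (rule arc)
  let ?K = "12 * (v - u + 1) * sqrt (2 / m)"
  have w: "0 \<le> (6 + 4 * M) / s ^ 16" "(6 + 4 * M) / s ^ 16 \<le> 1" using s M by auto
  have "outer_le (approximable u v M s) (4 * (1 + M) * s ^ 14 * ((v - u + 3) * (4 * ((6 + 4 * M) / s ^ 16))))"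
    unfolding approximable_def by (rule outer_le_approximable) (use w uv M s in auto)
  moreover have "4 * (1 + M) * s ^ 14 * ((v - u + 3) * (4 * ((6 + 4 * M) / s ^ 16)))
      \<le> 16 * (1 + M) * (6 + 4 * M) * (v - u + 3) / s"
  proof -
    have "s ^ 14 / s ^ 16 \<le> 1 / s"
    proof -
      have "s ^ 14 / s ^ 16 = 1 / (s * s)" using s by (simp add: field_simps flip: power_Suc power_add)
      also have "\<dots> \<le> 1 / s" using s by (simp add: field_simps)
      finally show ?thesis .
    qed
    then have "16 * (1 + M) * (6 + 4 * M) * (v - u + 3) * (s ^ 14 / s ^ 16)
        \<le> 16 * (1 + M) * (6 + 4 * M) * (v - u + 3) * (1 / s)"
      using M uv by (intro mult_left_mono) auto
    moreover have "4 * x * t * (y * (4 * (z / r))) = 16 * x * z * y * (t / r)" for x y z t r :: real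
      by simp
    ultimately show ?thesis by (simp only: mult_1_right times_divide_eq_right)
  qed
  ultimately have A: "outer_le (approximable u v M s) (16 * (1 + M) * (6 + 4 * M) * (v - u + 3) / s)"
    by (rule outer_le_mono[OF _ order_refl])
  have L: "outer_le (\<Union>n\<in>{n. n \<le> N \<and> 2 ^ n \<le> s ^ 22}. level f f' u v s (2 ^ n) - approximable u v M s) ((real N + 1) * (?K / s))"
  proof (rule outer_le_UN_const)
    show "real (card {n. n \<le> N \<and> 2 ^ n \<le> s ^ 22}) \<le> real N + 1"
    proof -
      have "card {n. n \<le> N \<and> 2 ^ n \<le> s ^ 22} \<le> card {..N}" by (rule card_mono) auto
      then show ?thesis by simp
    qed
    show "0 \<le> ?K / s" using uv m s by simp
  qed (use outer_le_level[OF arc] s in auto)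
  have "special f f' u v s \<subseteq> approximable u v M s \<union> (\<Union>n\<in>{n. n \<le> N \<and> 2 ^ n \<le> s ^ 22}. level f f' u v s (2 ^ n) - approximable u v M s)"
  proof
    fix x assume "x \<in> special f f' u v s"
    then obtain a b c where x: "x \<in> {u..v}" and nz: "\<not> (a = 0 \<and> b = 0 \<and> c = 0)" and
      F: "\<bar>F f a b c x\<bar> \<le> 1 / s ^ 40" "\<bar>F' f' b c x\<bar> \<le> 1 / s ^ 9" and c: "\<bar>real_of_int c\<bar> \<le> s ^ 22"
      unfolding special_def by blast
    have lt1: "1 / s ^ n < 1" if "n > 0" for n using s that by (simp add: one_less_power)
    \<comment> \<open>A dyadic size for \<open>c\<close> requires \<open>c\<close> to be nonzero.
      Otherwise \<open>F'\<close> is the integer \<open>b\<close> and then \<open>F\<close> the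
      integer \<open>a\<close>, both below 1 in absolute value and hence 0.\<close>
    have "c \<noteq> 0"
    proof
      assume c0: "c = 0"
      then have "\<bar>real_of_int b\<bar> < 1" using F(2) lt1[of 9] by (simp add: F'_def)
      then have "b = 0" by linarith
      then have "\<bar>real_of_int a\<bar> < 1" using F(1) lt1[of 40] c0 by (simp add: F_def)
      then show False using nz c0 \<open>b = 0\<close> by linarith
    qed
    then have "1 \<le> nat \<bar>c\<bar>" by linarith
    then obtain n where n: "2 ^ n \<le> nat \<bar>c\<bar>" "nat \<bar>c\<bar> < 2 ^ (n + 1)"
      using ex_power_ivl1[of 2 "nat \<bar>c\<bar>"] by auto
    have "real (2 ^ n) \<le> real (nat \<bar>c\<bar>)" "real (nat \<bar>c\<bar>) \<le> real (2 ^ (n + 1))"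
      using n by (simp_all only: of_nat_le_iff less_imp_le)
    then have c2: "2 ^ n \<le> \<bar>real_of_int c\<bar>" "\<bar>real_of_int c\<bar> \<le> 2 * 2 ^ n" by simp_all
    then have "(2::real) ^ n \<le> 2 ^ N" using c N by linarith
    then have "n \<le> N" by simp
    moreover have "2 ^ n \<le> s ^ 22" using c c2 by linarith
    moreover have "x \<in> level f f' u v s (2 ^ n)" using x c2 F unfolding level_def by blast
    ultimately show "x \<in> approximable u v M s \<union> (\<Union>n\<in>{n. n \<le> N \<and> 2 ^ n \<le> s ^ 22}. level f f' u v s (2 ^ n) - approximable u v M s)"
      by blast
  qed
  then show ?thesis
    by (rule outer_le_mono[OF outer_le_Un[OF A L]]) (simp add: add_divide_distrib add.commute)
qed

section \<open>Rational points near generic points of the arc\<close>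

definition block :: "(real \<Rightarrow> real) \<Rightarrow> real \<Rightarrow> real \<Rightarrow> real \<Rightarrow> real \<Rightarrow> real \<Rightarrow> real set" where
  "block f u v Q \<rho>1 \<rho>2 = {x \<in> {u..v}. \<exists>(q::int) (p::int) (r::int). Q \<le> q \<and> q < 2 * Q \<and>
     \<bar>p - q * x\<bar> < \<rho>1 \<and> \<bar>r - q * f x\<bar> < \<rho>2}"

text \<open>The condition on \<open>x\<close> bounds the diameter by \<open>2 * \<rho>1 / Q\<close>,
  the one on \<open>f x\<close> by \<open>2 * \<rho>2 / (c2 * Q)\<close> because \<open>f'\<close>
  is at least \<open>c2\<close>. Having the minimum here is what later produces the product of
  \<open>\<psi>1\<close> and \<open>\<psi>2\<close>.\<close>

lemma outer_le_near_point:
  fixes f f' f'' :: "real \<Rightarrow> real" and u v m M c1 c2 :: real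
    and q p r :: int and Q \<rho>1 \<rho>2 :: real
  assumes arc: "curved_arc f f' f'' u v m M c1 c2"
    and Q: "0 < Q" "Q \<le> q" and \<rho>: "0 < \<rho>1" "0 < \<rho>2"
  shows "outer_le {x \<in> {u..v}. \<bar>p - q * x\<bar> < \<rho>1 \<and> \<bar>r - q * f x\<bar> < \<rho>2}
           (2 * (2 * max 1 (1 / c2) * min \<rho>1 \<rho>2 / Q))"
proof -
  interpret curved_arc f f' f'' u v m M c1 c2 by (rule arc)
  show ?thesis
  proof (rule outer_le_diam)
    fix x y :: real
    assume x: "x \<in> {x \<in> {u..v}. \<bar>p - q * x\<bar> < \<rho>1 \<and> \<bar>r - q * f x\<bar> < \<rho>2}"
      and y: "y \<in> {x \<in> {u..v}. \<bar>p - q * x\<bar> < \<rho>1 \<and> \<bar>r - q * f x\<bar> < \<rho>2}" and le: "x \<le> y"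
    have "y \<in> {u..v}" "x \<in> {u..v}" using x y by simp_all
    from mvt_f[OF arc this] obtain z where z: "z \<in> {u..v}" "f y - f x = (y - x) * f' z"
      by (elim bexE conjE)
    have 1: "Q * (y - x) \<le> 2 * \<rho>1"
    proof -
      have "Q * (y - x) \<le> q * (y - x)" using Q le by (intro mult_right_mono) auto
      also have "\<dots> = (p - q * x) - (p - q * y)" by (simp add: algebra_simps)
      also have "\<dots> \<le> 2 * \<rho>1" using x y by (auto simp: abs_less_iff)
      finally show ?thesis .
    qed
    have 2: "Q * (y - x) * c2 \<le> 2 * \<rho>2"
    proof -
      have "Q * (y - x) * c2 \<le> q * (y - x) * f' z"
        using Q le f'_bounds[OF z(1)] c2 by (intro mult_mono mult_right_mono) auto
      also have "\<dots> = (r - q * f x) - (r - q * f y)"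
        using z(2) by (simp add: right_diff_distrib[symmetric] mult.assoc)
      also have "\<dots> \<le> 2 * \<rho>2" using x y by (auto simp: abs_less_iff)
      finally show ?thesis .
    qed
    have "Q * (y - x) \<le> 2 * \<rho>2 * (1 / c2)" using 2 c2 by (simp add: field_simps)
    also have "\<dots> \<le> 2 * \<rho>2 * max 1 (1 / c2)" using \<rho> by (intro mult_left_mono) auto
    finally have "Q * (y - x) \<le> 2 * \<rho>2 * max 1 (1 / c2)" .
    moreover have "2 * \<rho>1 * 1 \<le> 2 * \<rho>1 * max 1 (1 / c2)" using \<rho> by (intro mult_left_mono) auto
    then have "Q * (y - x) \<le> 2 * \<rho>1 * max 1 (1 / c2)" using 1 by linarith
    ultimately have "Q * (y - x) \<le> 2 * max 1 (1 / c2) * min \<rho>1 \<rho>2"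
      by (simp add: min_def mult_ac)
    then show "y - x \<le> 2 * max 1 (1 / c2) * min \<rho>1 \<rho>2 / Q" using Q by (simp add: field_simps)
  qed (use Q \<rho> in auto)
qed

text \<open>A box around a point \<open>z\<close> outside \<open>special f f' u v s\<close> contains no more integer points than its volume
  predicts; for arcs of length \<open>sqrt (\<delta> / Q)\<close> the curvature of the arc is absorbed by \<open>\<delta>\<close>.\<close>

lemma count_near_generic:
  fixes f f' f'' :: "real \<Rightarrow> real" and u v m M c1 c2 Q s \<delta> h :: real and V :: "(int \<times> int \<times> int) set"
  defines "D \<equiv> 3 + 2 * M + c1" and "h \<equiv> sqrt (\<delta> * Q)"
  assumes arc: "curved_arc f f' f'' u v m M c1 c2"
    and s: "s \<ge> 1" "Q = s ^ 40" and \<delta>: "1 / s ^ 22 \<le> \<delta>" "\<delta> \<le> 1"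
    and z: "z \<in> {u..v}" "z \<notin> special f f' u v s"
    and V: "\<And>q p r. (q, p, r) \<in> V \<Longrightarrow> 0 \<le> q \<and> real_of_int q \<le> 2 * Q \<and> (\<exists>x\<in>{u..v}. \<bar>x - z\<bar> \<le> h / Q \<and>
       \<bar>p - q * x\<bar> \<le> \<delta> \<and> \<bar>r - q * f x\<bar> \<le> \<delta>)"
  shows "finite V \<and> card V \<le> 4 * (18 * D) ^ 3 * (Q * h * \<delta>)"
proof -
  interpret curved_arc f f' f'' u v m M c1 c2 by (rule arc)
  have D: "D \<ge> 3" using M c1 by (simp add: D_def)
  have Q: "Q \<ge> 1" using s by simp
  have "0 < 1 / s ^ 22" using s by simp
  then have \<delta>0: "\<delta> > 0" using \<delta>(1) by (rule less_le_trans)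
  have h2: "h\<^sup>2 = \<delta> * Q" using \<delta>0 Q by (simp add: h_def)
  have h0: "h > 0" using \<delta>0 Q by (simp add: h_def)
  have "\<delta> * \<delta> \<le> \<delta> * Q" using \<delta> \<delta>0 Q by (intro mult_left_mono) auto
  then have \<delta>h: "\<delta> \<le> h" unfolding h_def by (intro real_le_rsqrt) (simp add: power2_eq_square)
  \<comment> \<open>This explains the threshold \<open>1 / s ^ 9\<close> in \<open>special\<close>:
    it is an upper bound for \<open>1 / h\<close>.\<close>
  have "(s ^ 9)\<^sup>2 \<le> \<delta> * Q"
  proof -
    have "(s ^ 9)\<^sup>2 = 1 / s ^ 22 * s ^ 40" using s by (simp add: field_simps flip: power_mult power_add)
    also have "\<dots> \<le> \<delta> * Q" unfolding s(2) using \<delta> s by (intro mult_right_mono) auto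
    finally show ?thesis .
  qed
  then have sh: "s ^ 9 \<le> h" unfolding h_def by (rule real_le_rsqrt)
  \<comment> \<open>The box around \<open>z\<close> has half-sides \<open>D * Q\<close>,
    \<open>D * h\<close> and \<open>D * \<delta>\<close>, where \<open>D\<close> absorbs the
    constants from curvature and slope; 18 is the normalisation of
    \<open>lattice_count\<close>.\<close>
  have "finite V \<and> card V \<le> 4 / (1 / (18 * D * Q) * (1 / (18 * D * h)) * (1 / (18 * D * \<delta>)))"
  proof (rule lattice_count[where x = z and y = "f z" and s = "f' z"])
    fix q p r :: int assume "(q, p, r) \<in> V"
    then obtain x :: real where x: "x \<in> {u..v}" "\<bar>x - z\<bar> \<le> h / Q" "\<bar>p - q * x\<bar> \<le> \<delta>" "\<bar>r - q * f x\<bar> \<le> \<delta>"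
      and q: "0 \<le> q" "real_of_int q \<le> 2 * Q" using V[of q p r] by blast
    have scale: "\<bar>w\<bar> * (1 / (18 * D * t)) \<le> 1/18" if "\<bar>w\<bar> \<le> D * t" "t > 0" for w t :: real
      using that D by (simp add: field_simps)
    have "2 * Q \<le> D * Q" using D Q by (intro mult_right_mono) auto
    then have "\<bar>real_of_int q\<bar> \<le> D * Q" using q by linarith
    then have b1: "\<bar>real_of_int q\<bar> * (1 / (18 * D * Q)) \<le> 1/18" using Q by (intro scale) auto
    have "real_of_int q * \<bar>x - z\<bar> \<le> 2 * Q * (h / Q)" using q x Q by (intro mult_mono) auto
    then have "\<bar>real_of_int q * (x - z)\<bar> \<le> 2 * h" using q Q by (simp add: abs_mult)
    moreover have "p - q * z = (p - q * x) + q * (x - z)" by (simp add: algebra_simps)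
    ultimately have "\<bar>p - q * z\<bar> \<le> 3 * h" using x(3) \<delta>h by linarith
    also have "\<dots> \<le> D * h" using D h0 by (intro mult_right_mono) auto
    finally have b2: "\<bar>p - q * z\<bar> * (1 / (18 * D * h)) \<le> 1/18" using h0 by (rule scale)
    \<comment> \<open>The window length \<open>h / Q\<close> is chosen so that the curvature error,
      multiplied by \<open>q\<close>, is of order \<open>\<delta>\<close>.\<close>
    have "\<bar>f x - f z - f' z * (x - z)\<bar> \<le> M * (h / Q)\<^sup>2"
    proof -
      have "\<bar>x - z\<bar>\<^sup>2 \<le> (h / Q)\<^sup>2" using x(2) by (intro power_mono) auto
      then show ?thesis using f_taylor[OF arc x(1) z(1)] mult_left_mono[OF _ M] by force
    qed
    then have "real_of_int q * \<bar>f x - f z - f' z * (x - z)\<bar> \<le> 2 * Q * (M * (h / Q)\<^sup>2)"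
      using q Q by (intro mult_mono) auto
    also have "\<dots> = 2 * M * \<delta>" using Q by (simp add: power_divide h2) (simp add: power2_eq_square)
    finally have "\<bar>real_of_int q * (f x - f z - f' z * (x - z))\<bar> \<le> 2 * M * \<delta>" using q by (simp add: abs_mult)
    moreover have "\<bar>- f' z * (p - q * x)\<bar> \<le> c1 * \<delta>"
      unfolding abs_mult abs_minus_cancel using f'_bounds[OF z(1)] c2 x(3) by (intro mult_mono) auto
    moreover have "r - q * f z - f' z * (p - q * z)
        = (r - q * f x) + q * (f x - f z - f' z * (x - z)) + - f' z * (p - q * x)"
      by (simp add: algebra_simps)
    ultimately have "\<bar>r - q * f z - f' z * (p - q * z)\<bar> \<le> \<delta> + 2 * M * \<delta> + c1 * \<delta>"
      using x(4) by (simp only: abs_add3_le)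
    also have "\<dots> \<le> D * \<delta>" using \<delta>0 by (simp add: D_def algebra_simps)
    finally have "\<bar>r - q * f z - f' z * (p - q * z)\<bar> * (1 / (18 * D * \<delta>)) \<le> 1/18" using \<delta>0 by (rule scale)
    then show "\<bar>real_of_int q\<bar> * (1 / (18 * D * Q)) \<le> 1/18 \<and> \<bar>p - q * z\<bar> * (1 / (18 * D * h)) \<le> 1/18 \<and>
        \<bar>r - q * f z - f' z * (p - q * z)\<bar> * (1 / (18 * D * \<delta>)) \<le> 1/18"
      using b1 b2 by blast
  next
    fix a b c :: int
    assume a: "\<bar>a + b * z + c * f z\<bar> \<le> 2 * (1 / (18 * D * Q))" "\<bar>b + c * f' z\<bar> \<le> 2 * (1 / (18 * D * h))"
      "\<bar>real_of_int c\<bar> \<le> 2 * (1 / (18 * D * \<delta>))"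
    \<comment> \<open>A nonzero integer point of the doubled polar box would be a line making
      \<open>z\<close> special.\<close>
    have le: "2 * (1 / (18 * D * t)) \<le> 1 / t" if "t > 0" for t
      using that D by (simp add: field_simps)
    have "1 / h \<le> 1 / s ^ 9" using sh s h0 by (intro divide_left_mono) auto
    moreover have "1 / \<delta> \<le> s ^ 22" using \<delta>(1) \<delta>0 s by (simp add: field_simps)
    ultimately have "\<bar>F f a b c z\<bar> \<le> 1 / s ^ 40 \<and> \<bar>F' f' b c z\<bar> \<le> 1 / s ^ 9 \<and> \<bar>real_of_int c\<bar> \<le> s ^ 22"
      unfolding F_def F'_def s(2)[symmetric]
      using order_trans[OF a(1) le[of Q]] order_trans[OF a(2) le[OF h0]] order_trans[OF a(3) le[OF \<delta>0]] Q
      by auto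
    then show "a = 0 \<and> b = 0 \<and> c = 0" using z unfolding special_def by blast
  qed (use D Q h0 \<delta>0 in auto)
  moreover have "4 / (1 / (18 * D * Q) * (1 / (18 * D * h)) * (1 / (18 * D * \<delta>))) = 4 * (18 * D) ^ 3 * (Q * h * \<delta>)"
    by (simp add: power3_eq_cube)
  ultimately show ?thesis by (simp only:)
qed

definition block_const :: "real \<Rightarrow> real \<Rightarrow> real \<Rightarrow> real \<Rightarrow> real \<Rightarrow> real" where
  "block_const u v M c1 c2 = (v - u + 1) * (16 * max 1 (1 / c2) * (18 * (3 + 2 * M + c1)) ^ 3)"

text \<open>A window of length \<open>h / Q\<close> is either empty or contains a generic
  \<open>z\<close>. Then \<open>count_near_generic\<close> bounds the number of rational points and
  \<open>outer_le_near_point\<close> the cost of each; the number \<open>O(Q / h)\<close> of windows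
  cancels the factor \<open>h\<close>.\<close>

lemma outer_le_block:
  fixes f f' f'' :: "real \<Rightarrow> real" and u v m M c1 c2 :: real
  assumes arc: "curved_arc f f' f'' u v m M c1 c2"
    and s: "s \<ge> 1" "Q = s ^ 40" and \<delta>: "1 / s ^ 22 \<le> \<delta>" "\<delta> \<le> 1"
    and \<rho>: "0 < \<rho>1" "0 < \<rho>2" "\<rho>1 \<le> \<delta>" "\<rho>2 \<le> \<delta>"
  shows "outer_le (block f u v Q \<rho>1 \<rho>2 - special f f' u v s) (block_const u v M c1 c2 * (Q * \<delta> * min \<rho>1 \<rho>2))"
proof -
  interpret curved_arc f f' f'' u v m M c1 c2 by (rule arc)
  define h where "h = sqrt (\<delta> * Q)"
  define \<mu> where "\<mu> = min \<rho>1 \<rho>2"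
  define e where "e = max 1 (1 / c2)"
  define K where "K = (18 * (3 + 2 * M + c1)) ^ 3"
  have Q: "Q \<ge> 1" using s by simp
  have \<delta>0: "\<delta> > 0" using \<rho> by linarith
  have h0: "h > 0" using \<delta>0 Q by (simp add: h_def)
  have h2: "h * h = \<delta> * Q" using \<delta>0 Q by (simp add: h_def)
  have \<mu>: "\<mu> > 0" using \<rho> by (simp add: \<mu>_def)
  have e: "e > 0" by (simp add: e_def)
  have K: "K > 0" using M c1 by (simp add: K_def)
  define C where "C = 4 * K * (Q * h * \<delta>) * (2 * (2 * e * \<mu> / Q))"
  have C: "C = 16 * e * K * (h * \<delta> * \<mu>)" using Q by (simp add: C_def)
  have each: "outer_le ((block f u v Q \<rho>1 \<rho>2 - special f f' u v s) \<inter> {t..t + h / Q}) C" for t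
  proof (cases "(block f u v Q \<rho>1 \<rho>2 - special f f' u v s) \<inter> {t..t + h / Q} = {}")
    case True
    then show ?thesis unfolding C using e K h0 \<delta>0 \<mu> by (simp add: outer_le_empty)
  next
    case False
    then obtain z where z: "z \<in> {u..v}" "z \<notin> special f f' u v s" "z \<in> {t..t + h / Q}" unfolding block_def by blast
    define near where "near = (\<lambda>(q::int, p::int, r::int). {x \<in> {u..v}. \<bar>p - q * x\<bar> < \<rho>1 \<and> \<bar>r - q * f x\<bar> < \<rho>2})"
    define V where "V = {(q::int, p::int, r::int). Q \<le> q \<and> q < 2 * Q \<and> near (q, p, r) \<inter> {t..t + h / Q} \<noteq> {}}"
    have V: "finite V \<and> card V \<le> 4 * K * (Q * h * \<delta>)"
      unfolding K_def h_def
    proof (rule count_near_generic[OF arc s \<delta> z(1,2)], fold h_def)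
      fix q p r :: int assume "(q, p, r) \<in> V"
      then obtain x where x: "Q \<le> q" "q < 2 * Q" "x \<in> near (q, p, r)" "x \<in> {t..t + h / Q}"
        unfolding V_def by blast
      then have x': "x \<in> {u..v}" "\<bar>p - q * x\<bar> < \<rho>1" "\<bar>r - q * f x\<bar> < \<rho>2"
        by (simp_all add: near_def)
      have "\<bar>x - z\<bar> \<le> h / Q" using x(4) z(3) by (auto simp: abs_le_iff)
      then show "0 \<le> q \<and> real_of_int q \<le> 2 * Q \<and> (\<exists>x\<in>{u..v}. \<bar>x - z\<bar> \<le> h / Q \<and>
          \<bar>p - q * x\<bar> \<le> \<delta> \<and> \<bar>r - q * f x\<bar> \<le> \<delta>)"
        using x(1,2) x' \<rho>(3,4) Q by (intro conjI bexI[of _ x]) linarith+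
    qed
    have "outer_le (\<Union>w\<in>V. near w) C"
      unfolding C_def
    proof (rule outer_le_UN_const)
      fix w assume "w \<in> V"
      then obtain q p r where w: "w = (q, p, r)" "Q \<le> real_of_int q" unfolding V_def by blast
      show "outer_le (near w) (2 * (2 * e * \<mu> / Q))"
        unfolding w near_def e_def \<mu>_def split using Q w \<rho> by (intro outer_le_near_point[OF arc]) auto
    qed (use V e \<mu> Q in auto)
    moreover have "(block f u v Q \<rho>1 \<rho>2 - special f f' u v s) \<inter> {t..t + h / Q} \<subseteq> (\<Union>w\<in>V. near w)"
    proof
      fix x assume x: "x \<in> (block f u v Q \<rho>1 \<rho>2 - special f f' u v s) \<inter> {t..t + h / Q}"
      then obtain q p r where qpr: "Q \<le> real_of_int q" "q < 2 * Q" "x \<in> near (q, p, r)"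
        unfolding block_def near_def by auto
      then have "(q, p, r) \<in> V" using x unfolding V_def by auto
      then show "x \<in> (\<Union>w\<in>V. near w)" using qpr by blast
    qed
    ultimately show ?thesis by (rule outer_le_mono) simp
  qed
  have "outer_le (block f u v Q \<rho>1 \<rho>2 - special f f' u v s) (((v - u) / (h / Q) + 1) * C)"
    by (rule outer_le_partition[OF _ _ _ _ each])
       (use h0 Q e K \<delta>0 \<mu> uv in \<open>auto simp: C block_def\<close>)
  moreover have "((v - u) / (h / Q) + 1) * C \<le> block_const u v M c1 c2 * (Q * \<delta> * min \<rho>1 \<rho>2)"
  proof -
    \<comment> \<open>Windows have length at most 1, which absorbs the additional one into
      \<open>v - u + 1\<close>.\<close>
    have "h\<^sup>2 \<le> Q\<^sup>2"
      unfolding power2_eq_square h2 using \<delta> \<delta>0 Q by (intro mult_mono) auto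
    then have "h \<le> Q" by (rule power2_le_imp_le) (use Q in simp)
    then have "(v - u) / (h / Q) + 1 \<le> (v - u + 1) * (Q / h)"
      using h0 by (simp add: algebra_simps add_divide_distrib diff_divide_distrib)
    then have "((v - u) / (h / Q) + 1) * C \<le> (v - u + 1) * (Q / h) * C"
      unfolding C using e K h0 \<delta>0 \<mu> by (intro mult_right_mono) auto
    also have "\<dots> = (v - u + 1) * (16 * e * K) * (Q * \<delta> * \<mu>)" unfolding C using h0 by simp
    finally show ?thesis by (simp add: block_const_def e_def K_def \<mu>_def)
  qed
  ultimately show ?thesis by (rule outer_le_mono[OF _ order_refl])
qed

section \<open>Convergence\<close>

lemma null_sets_approximable:
  fixes f f' f'' :: "real \<Rightarrow> real" and u v m M c1 c2 :: real
  assumes arc: "curved_arc f f' f'' u v m M c1 c2"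
    and pos: "\<And>t. t > 0 \<Longrightarrow> \<psi>1 t > 0 \<and> \<psi>2 t > 0"
    and dec: "antimono_on {0<..} \<psi>1" "antimono_on {0<..} \<psi>2"
    and sum: "summable (\<lambda>h::nat. \<psi>1 (real (Suc h)) * \<psi>2 (real (Suc h)))"
  shows "{x \<in> {u..v}. (x, f x) \<in> S2 \<psi>1 \<psi>2} \<in> null_sets lebesgue"
proof -
  interpret curved_arc f f' f'' u v m M c1 c2 by (rule arc)
  \<comment> \<open>With this base \<open>s k ^ 40 = 2 ^ k\<close> holds exactly, and all powers of
    \<open>Q\<close> become integral powers of \<open>s k\<close>.\<close>
  define \<theta> :: real where "\<theta> = root 40 2"
  have \<theta>: "\<theta> > 1" "\<theta> ^ 40 = 2" by (simp_all add: \<theta>_def)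
  define s where "s k = \<theta> ^ k" for k :: nat
  have s40: "s k ^ 40 = 2 ^ k" for k
  proof -
    have "s k ^ 40 = (\<theta> ^ 40) ^ k" unfolding s_def by (simp only: mult.commute flip: power_mult)
    then show ?thesis by (simp only: \<theta>(2))
  qed
  have s1: "s k \<ge> 1" for k using \<theta> by (simp add: s_def)
  define \<rho>1 where "\<rho>1 k = min 1 (\<psi>1 (2 ^ k))" for k :: nat
  define \<rho>2 where "\<rho>2 k = min 1 (\<psi>2 (2 ^ k))" for k :: nat
  \<comment> \<open>The cutoff \<open>1 / s k ^ 22\<close> is \<open>Q powr (-11/20)\<close>; it
    keeps \<open>\<delta>\<close> large enough for the lattice count.\<close>
  define \<delta> where "\<delta> k = max (max (\<rho>1 k) (\<rho>2 k)) (1 / s k ^ 22)" for k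
  define A where "A = 16 * (1 + M) * (6 + 4 * M) * (v - u + 3)"
  define B where "B = 12 * (v - u + 1) * sqrt (2 / m)"
  define b where "b k = (A + (real k + 1) * B) / s k
    + block_const u v M c1 c2 * (2 ^ k * (\<psi>1 (2 ^ k) * \<psi>2 (2 ^ k)) + 1 / s k)" for k :: nat
  have dec': "\<psi>1 y \<le> \<psi>1 x \<and> \<psi>2 y \<le> \<psi>2 x" if "0 < x" "x \<le> y" for x y
    using dec that by (auto simp: monotone_on_def)
  have \<rho>: "0 < \<rho>1 k" "0 < \<rho>2 k" "\<rho>1 k \<le> 1" "\<rho>2 k \<le> 1" for k
    using pos[of "2 ^ k"] by (auto simp: \<rho>1_def \<rho>2_def)
  have bc: "block_const u v M c1 c2 \<ge> 0" using uv M c1 by (simp add: block_const_def)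
  obtain k0 where k0: "6 + 4 * M < \<theta> ^ k0" using real_arch_pow[OF \<theta>(1)] by blast
  show ?thesis
  proof (rule negligible_limsup_outer_le)
    fix k assume k: "k \<ge> k0"
    have large: "s k ^ 16 > 6 + 4 * M" and "s k > 1"
    proof -
      have "\<theta> ^ k0 \<le> \<theta> ^ k" using k \<theta> by (intro power_increasing) auto
      then have "6 + 4 * M < s k" using k0 by (simp add: s_def)
      moreover have "s k ^ 1 \<le> s k ^ 16" using s1 by (intro power_increasing) auto
      ultimately show "s k ^ 16 > 6 + 4 * M" "s k > 1" using M by auto
    qed
    \<comment> \<open>Hence \<open>N = k\<close> is admissible as the bound for the dyadic levels of
      \<open>c\<close>.\<close>
    have "s k ^ 22 \<le> s k ^ 40" using s1 by (intro power_increasing) auto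
    then have "s k ^ 22 \<le> 2 ^ k" by (simp add: s40)
    then have 1: "outer_le (special f f' u v (s k)) ((A + (real k + 1) * B) / s k)"
      unfolding A_def B_def using \<open>s k > 1\<close> large by (rule outer_le_special[OF arc, rotated 2])
    have \<delta>: "1 / s k ^ 22 \<le> \<delta> k" "\<delta> k \<le> 1" "\<rho>1 k \<le> \<delta> k" "\<rho>2 k \<le> \<delta> k"
      using \<rho>[of k] s1[of k] by (auto simp: \<delta>_def)
    have "outer_le (block f u v (2 ^ k) (\<rho>1 k) (\<rho>2 k) - special f f' u v (s k))
       (block_const u v M c1 c2 * (2 ^ k * \<delta> k * min (\<rho>1 k) (\<rho>2 k)))"
      using s1 s40 \<delta> \<rho> by (intro outer_le_block[OF arc]) auto
    moreover have "2 ^ k * \<delta> k * min (\<rho>1 k) (\<rho>2 k) \<le> 2 ^ k * (\<psi>1 (2 ^ k) * \<psi>2 (2 ^ k)) + 1 / s k"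
    proof -
      have "max (\<rho>1 k) (\<rho>2 k) * min (\<rho>1 k) (\<rho>2 k) = \<rho>1 k * \<rho>2 k" by (simp add: max_def min_def)
      also have "\<dots> \<le> \<psi>1 (2 ^ k) * \<psi>2 (2 ^ k)"
        using pos[of "2 ^ k"] by (intro mult_mono) (auto simp: \<rho>1_def \<rho>2_def)
      finally have le1: "max (\<rho>1 k) (\<rho>2 k) * min (\<rho>1 k) (\<rho>2 k) \<le> \<psi>1 (2 ^ k) * \<psi>2 (2 ^ k)" .
      show ?thesis
      \<comment> \<open>If the maximum dominates, its product with the minimum is
        \<open>\<rho>1 k * \<rho>2 k\<close>. Otherwise both thresholds lie below the cutoff, and
        the exponent \<open>40 - 22 - 22 = -4\<close> of \<open>s k\<close> leaves geometric
        decay.\<close>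
      proof (cases "max (\<rho>1 k) (\<rho>2 k) \<ge> 1 / s k ^ 22")
        case True
        then have "\<delta> k = max (\<rho>1 k) (\<rho>2 k)" by (simp add: \<delta>_def)
        then have "2 ^ k * \<delta> k * min (\<rho>1 k) (\<rho>2 k) \<le> 2 ^ k * (\<psi>1 (2 ^ k) * \<psi>2 (2 ^ k))"
          using le1 by (simp add: mult.assoc)
        moreover have "0 \<le> 1 / s k" using s1[of k] by simp
        ultimately show ?thesis by linarith
      next
        case False
        then have "\<delta> k = 1 / s k ^ 22" "min (\<rho>1 k) (\<rho>2 k) \<le> 1 / s k ^ 22" by (auto simp: \<delta>_def)
        moreover have "2 ^ k * (1 / s k ^ 22) * min (\<rho>1 k) (\<rho>2 k) \<le> 2 ^ k * (1 / s k ^ 22) * (1 / s k ^ 22)"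
          using calculation(2) s1[of k] by (intro mult_left_mono) auto
        ultimately have "2 ^ k * \<delta> k * min (\<rho>1 k) (\<rho>2 k) \<le> s k ^ 40 * (1 / s k ^ 22) * (1 / s k ^ 22)"
          by (simp only: s40)
        also have "\<dots> = 1 / s k ^ 4" using s1[of k] by (simp add: field_simps flip: power_add)
        also have "\<dots> \<le> 1 / s k ^ 1" using s1[of k] by (intro divide_left_mono power_increasing) auto
        also have "\<dots> \<le> 2 ^ k * (\<psi>1 (2 ^ k) * \<psi>2 (2 ^ k)) + 1 / s k" using pos[of "2 ^ k"] by simp
        finally show ?thesis .
      qed
    qed
    ultimately have 2: "outer_le (block f u v (2 ^ k) (\<rho>1 k) (\<rho>2 k) - special f f' u v (s k))
       (block_const u v M c1 c2 * (2 ^ k * (\<psi>1 (2 ^ k) * \<psi>2 (2 ^ k)) + 1 / s k))"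
      by (rule outer_le_mono[OF _ order_refl mult_left_mono[OF _ bc]])
    show "outer_le (block f u v (2 ^ k) (\<rho>1 k) (\<rho>2 k)) (b k)"
      by (rule outer_le_mono[OF outer_le_Un[OF 1 2]]) (auto simp: b_def)
  next
    have inv: "1 / s k = (1 / \<theta>) ^ k" for k by (simp add: s_def power_one_over)
    have n1: "norm (1 / \<theta>) < 1" using \<theta> by simp
    have g1: "summable (\<lambda>k. 1 / s k)" unfolding inv using n1 by (rule summable_geometric)
    \<comment> \<open>The linear factor from the number of levels is harmless against geometric
      decay.\<close>
    have g2: "summable (\<lambda>k. (real k + 1) * (1 / s k))"
      unfolding inv using geometric_deriv_sums[OF n1] by (auto simp: sums_iff add.commute)
    have g3: "summable (\<lambda>k. 2 ^ k * (\<psi>1 (2 ^ k) * \<psi>2 (2 ^ k)))"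
      by (rule summable_dyadic[where g = "\<lambda>t. \<psi>1 t * \<psi>2 t"])
         (use pos dec' sum in \<open>auto intro!: mult_mono simp: less_imp_le\<close>)
    have "b = (\<lambda>k. A * (1 / s k) + B * ((real k + 1) * (1 / s k))
        + block_const u v M c1 c2 * (2 ^ k * (\<psi>1 (2 ^ k) * \<psi>2 (2 ^ k)) + 1 / s k))"
      by (rule ext) (simp add: b_def divide_inverse algebra_simps)
    then show "summable b"
      using g1 g2 g3 by (simp only:) (intro summable_add summable_mult)
  next
    fix x N assume "x \<in> {x \<in> {u..v}. (x, f x) \<in> S2 \<psi>1 \<psi>2}"
    then have x: "x \<in> {u..v}" and "infinite {q::nat. q > 0 \<and>
       dist_nint (real q * x) < \<psi>1 (real q) \<and> dist_nint (real q * f x) < \<psi>2 (real q)}"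
      unfolding S2_def by auto
    \<comment> \<open>Choosing \<open>q\<close> beyond \<open>2 ^ N\<close> forces its dyadic index
      \<open>k\<close> to be at least \<open>N\<close>.\<close>
    then obtain q :: nat where q: "q > 2 ^ N" "dist_nint (real q * x) < \<psi>1 (real q)"
      "dist_nint (real q * f x) < \<psi>2 (real q)"
      unfolding infinite_nat_iff_unbounded by blast
    then obtain k where k: "2 ^ k \<le> q" "q < 2 ^ (k + 1)"
      using ex_power_ivl1[of 2 q] by auto
    have "(2::nat) ^ N < 2 ^ (k + 1)" using q(1) k(2) by linarith
    then have "N \<le> k" by (simp add: power_strict_increasing_iff del: power_Suc)
    have "real (2 ^ k) \<le> real q" "real q < real (2 ^ (k + 1))"
      using k by (simp_all only: of_nat_le_iff of_nat_less_iff)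
    then have k': "2 ^ k \<le> real q" "real q < 2 * 2 ^ k" by simp_all
    obtain p where p: "\<bar>real_of_int p - real q * x\<bar> < min 1 (\<psi>1 (real q))" using q(2) by (rule dist_nint_less)
    obtain r where r: "\<bar>real_of_int r - real q * f x\<bar> < min 1 (\<psi>2 (real q))" using q(3) by (rule dist_nint_less)
    have "\<psi>1 (real q) \<le> \<psi>1 (2 ^ k)" "\<psi>2 (real q) \<le> \<psi>2 (2 ^ k)" using dec'[of "2 ^ k" "real q"] k' by auto
    then have "\<bar>real_of_int p - real_of_int (int q) * x\<bar> < \<rho>1 k"
      "\<bar>real_of_int r - real_of_int (int q) * f x\<bar> < \<rho>2 k"
      using p r by (simp_all add: \<rho>1_def \<rho>2_def)
    moreover have "2 ^ k \<le> real_of_int (int q)" "real_of_int (int q) < 2 * 2 ^ k" using k' by simp_all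
    ultimately have "x \<in> block f u v (2 ^ k) (\<rho>1 k) (\<rho>2 k)" unfolding block_def using x by blast
    then show "\<exists>k\<ge>N. x \<in> block f u v (2 ^ k) (\<rho>1 k) (\<rho>2 k)" using \<open>N \<le> k\<close> by blast
  qed
qed

section \<open>From compact arcs to the open interval\<close>

text \<open>The extreme values of \<open>\<bar>g\<bar>\<close> on the compact interval give
  \<open>m\<close> and \<open>M\<close>; connectedness of the image excludes a change of
  sign.\<close>

lemma nonzero_continuous_bounds:
  fixes g :: "real \<Rightarrow> real"
  assumes "u \<le> v" and cont: "continuous_on {u..v} g" and nz: "\<And>x. x \<in> {u..v} \<Longrightarrow> g x \<noteq> 0"
  obtains m M where "0 < m" "\<forall>x\<in>{u..v}. \<bar>g x\<bar> \<le> M"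
    "(\<forall>x\<in>{u..v}. m \<le> g x) \<or> (\<forall>x\<in>{u..v}. g x \<le> - m)"
proof -
  have ne: "{u..v} \<noteq> {}" using assms(1) by simp
  have c: "continuous_on {u..v} (\<lambda>x. \<bar>g x\<bar>)" by (intro continuous_intros cont)
  obtain y where y: "y \<in> {u..v}" "\<And>x. x \<in> {u..v} \<Longrightarrow> \<bar>g y\<bar> \<le> \<bar>g x\<bar>"
    using continuous_attains_inf[OF compact_Icc ne c] by blast
  obtain z where z: "z \<in> {u..v}" "\<And>x. x \<in> {u..v} \<Longrightarrow> \<bar>g x\<bar> \<le> \<bar>g z\<bar>"
    using continuous_attains_sup[OF compact_Icc ne c] by blast
  have conn: "connected (g ` {u..v})" using connected_continuous_image[OF cont] by simp
  have "(\<forall>x\<in>{u..v}. 0 < g x) \<or> (\<forall>x\<in>{u..v}. g x < 0)"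
  proof (rule ccontr)
    assume "\<not> ?thesis"
    then obtain a b where ab: "a \<in> {u..v}" "b \<in> {u..v}" "g a \<le> 0" "0 \<le> g b"
      by (meson linorder_not_less)
    then have "0 \<in> g ` {u..v}" using conn unfolding connected_iff_interval by blast
    then show False using nz by auto
  qed
  then have "(\<forall>x\<in>{u..v}. \<bar>g y\<bar> \<le> g x) \<or> (\<forall>x\<in>{u..v}. g x \<le> - \<bar>g y\<bar>)"
  proof
    assume "\<forall>x\<in>{u..v}. 0 < g x"
    then show ?thesis using y(2) by (intro disjI1) force
  next
    assume "\<forall>x\<in>{u..v}. g x < 0"
    then show ?thesis using y(2) by (intro disjI2) force
  qed
  then show thesis using that[of "\<bar>g y\<bar>" "\<bar>g z\<bar>"] z y(1) nz by auto
qed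

theorem theorem2:
  fixes I :: "real set" and f f' f'' f''' :: "real \<Rightarrow> real"
    and \<psi>1 \<psi>2 :: "real \<Rightarrow> real" and c1 c2 :: real
  assumes I_open: "open I" and I_interval: "is_interval I" and I_ne: "I \<noteq> {}"
    and d1: "\<And>x. x \<in> I \<Longrightarrow> (f has_real_derivative f' x) (at x)"
    and d2: "\<And>x. x \<in> I \<Longrightarrow> (f' has_real_derivative f'' x) (at x)"
    and d3: "\<And>x. x \<in> I \<Longrightarrow> (f'' has_real_derivative f''' x) (at x)"
    and cont3: "continuous_on I f'''"
    and c: "c1 > c2" "c2 > 0"
    and fbound: "\<And>x. x \<in> I \<Longrightarrow> c2 < f' x \<and> f' x < c1"
    and f2nz: "\<And>x. x \<in> I \<Longrightarrow> f'' x \<noteq> 0"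
    and psi_pos: "\<And>t. t > 0 \<Longrightarrow> \<psi>1 t > 0 \<and> \<psi>2 t > 0"
    and psi_dec: "antimono_on {0<..} \<psi>1" "antimono_on {0<..} \<psi>2"
    and sum: "summable (\<lambda>h::nat. \<psi>1 (real (Suc h)) * \<psi>2 (real (Suc h)))"
  shows "{x \<in> I. (x, f x) \<in> S2 \<psi>1 \<psi>2} \<in> null_sets lebesgue"
proof -
  have arc: "{x \<in> {u..v}. (x, f x) \<in> S2 \<psi>1 \<psi>2} \<in> null_sets lebesgue"
    if uv: "u < v" "{u..v} \<subseteq> I" for u v
  proof -
    have "continuous_on {u..v} f''"
      using d3 uv by (intro continuous_at_imp_continuous_on) (auto intro: DERIV_isCont)
    moreover have "f'' x \<noteq> 0" if "x \<in> {u..v}" for x using f2nz uv that by blast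
    ultimately obtain m M where mM: "0 < m" "\<forall>x\<in>{u..v}. \<bar>f'' x\<bar> \<le> M"
      "(\<forall>x\<in>{u..v}. m \<le> f'' x) \<or> (\<forall>x\<in>{u..v}. f'' x \<le> - m)"
      by (rule nonzero_continuous_bounds[OF less_imp_le[OF uv(1)]]) blast
    have "\<bar>f'' u\<bar> \<le> M" using mM(2) uv(1) by simp
    then have M: "0 \<le> M" by linarith
    have "curved_arc f f' f'' u v m M c1 c2"
    proof
      fix x assume "x \<in> {u..v}"
      then have x: "x \<in> I" using uv by blast
      show "(f has_real_derivative f' x) (at x)" "(f' has_real_derivative f'' x) (at x)"
        using x by (rule d1 d2)+
      show "c2 \<le> f' x \<and> f' x \<le> c1" using fbound[OF x] by simp
      show "\<bar>f'' x\<bar> \<le> M" using mM(2) \<open>x \<in> {u..v}\<close> by blast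
    qed (rule uv mM M c less_trans[OF c(2,1)])+
    then show ?thesis by (rule null_sets_approximable[OF _ psi_pos psi_dec sum])
  qed
  \<comment> \<open>Curvature bounds are available only on compact subintervals; those with rational
    endpoints are countably many and cover the open set \<open>I\<close>.\<close>
  define R where "R = {(u, v). u \<in> \<rat> \<and> v \<in> \<rat> \<and> u < v \<and> {u..v} \<subseteq> I}"
  have "R \<subseteq> \<rat> \<times> \<rat>" by (auto simp: R_def)
  then have "countable R" by (rule countable_subset) (intro countable_SIGMA countable_rat)
  then have "(\<Union>(u, v)\<in>R. {x \<in> {u..v}. (x, f x) \<in> S2 \<psi>1 \<psi>2}) \<in> null_sets lebesgue"
    by (rule null_sets_UN') (auto simp: R_def simp del: atLeastAtMost_iff intro: arc)
  moreover have "{x \<in> I. (x, f x) \<in> S2 \<psi>1 \<psi>2} = (\<Union>(u, v)\<in>R. {x \<in> {u..v}. (x, f x) \<in> S2 \<psi>1 \<psi>2})"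
  proof -
    have "\<exists>(u, v)\<in>R. x \<in> {u..v}" if x: "x \<in> I" for x
    proof -
      obtain e where e: "e > 0" "ball x e \<subseteq> I" using I_open x openE by blast
      obtain u where u: "u \<in> \<rat>" "x - e < u" "u < x" using Rats_dense_in_real[of "x - e" x] e by auto
      obtain v where v: "v \<in> \<rat>" "x < v" "v < x + e" using Rats_dense_in_real[of x "x + e"] e by auto
      have "{u..v} \<subseteq> ball x e" using u v by (auto simp: dist_real_def)
      then show ?thesis using u v e by (intro bexI[of _ "(u, v)"]) (auto simp: R_def)
    qed
    then show ?thesis unfolding R_def by blast
  qed
  ultimately show ?thesis by simp
qed

end
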